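(* Let $\Gamma$ be a countable group acting by $C^r$ diffeomorphisms on a compact manifold $M$. Assume the action preserves a rigid geometric structure $\omega$ of order $r$ on $M$. Then $\Gamma=\mathrm{Inn}^r(M,\Gamma)$.
   Context: Manifolds are smooth; $n=\dim M$. $\Gamma$ is identified with its image in $\mathrm{Diff}^r(M)$. $\mathrm{Inn}^r(M,\Gamma)$ is the group of $C^r$ diffeomorphisms $f$ of $M$ with $f(x)\in\Gamma x$ for every $x\in M$. Let $D^k$ be the group of $k$-jets at $0$ of diffeomorphisms of $\mathbb{R}^n$ fixing the origin, and let $P^k(M)$ be the $k$-th order frame bundle of $M$, a principal $D^k$-bundle. A geometric structure on $M$ (of order $k$) consists of a manifold $V$, an action of $D^k$ on $V$, and a continuous $D^k$-equivariant map $\omega:P^k(M)\to V$; it is denoted by $\omega$. For $r\ge k$, a $C^r$ diffeomorphism $g$ of $M$ acts on $P^r(M)$ and $P^k(M)$, and $g$ preserves $\omega$ if $\omega\circ g^{k}=\omega$, where $g^{k}:P^k(M)\to P^k(M)$ is the induced map. $\mathrm{Aut}^r(\omega)$ denotes the group of $C^r$ diffeomorphisms of $M$ preserving $\omega$ (with the $C^r$ topology). The action of $\Gamma$ preserves $\omega$ if every element of $\Gamma$ acts by an element of $\mathrm{Aut}^r(\omega)$. The geometric structure $\omega$ is rigid of order $r$ if the action of $\mathrm{Aut}^r(\omega)$ on $P^r(M)$ is free and proper. *)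

theory Defs
  imports "HOL-Analysis.Analysis" "HOL-Algebra.Group_Action"
begin

section \<open>Differentiability of order $k$\<close>

text \<open>Iterated derivative of \<open>f\<close> in the directions \<open>vs\<close>. For a \<open>k\<close> times continuously
  differentiable \<open>f\<close> and \<open>j \<le> k\<close>, the values on lists of length \<open>j\<close> form the \<open>j\<close>-th
  derivative of \<open>f\<close> as a symmetric \<open>j\<close>-linear map.\<close>

fun deriv_along ::
  "('e::real_normed_vector \<Rightarrow> 'f::real_normed_vector) \<Rightarrow> 'e list \<Rightarrow> 'e \<Rightarrow> 'f" where
  "deriv_along f [] = f"
| "deriv_along f (v # vs) = deriv_along (\<lambda>x. frechet_derivative f (at x) v) vs"

text \<open>Only meant for open \<open>S\<close> and finite-dimensional \<open>'e\<close>, where continuity of all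
  directional derivatives is continuity of the total derivative.\<close>

fun Ck_on ::
  "nat \<Rightarrow> 'e::real_normed_vector set \<Rightarrow> ('e \<Rightarrow> 'f::real_normed_vector) \<Rightarrow> bool" where
  "Ck_on 0 S f \<longleftrightarrow> continuous_on S f"
| "Ck_on (Suc k) S f \<longleftrightarrow>
     (\<forall>x\<in>S. f differentiable (at x)) \<and>
     (\<forall>v. Ck_on k S (\<lambda>x. frechet_derivative f (at x) v))"

definition smooth_on ::
  "'e::real_normed_vector set \<Rightarrow> ('e \<Rightarrow> 'f::real_normed_vector) \<Rightarrow> bool" where
  "smooth_on S f \<longleftrightarrow> (\<forall>k. Ck_on k S f)"

section \<open>Manifolds\<close>

text \<open>Manifolds of dimension \<open>n\<close> are modelled on an \<open>n\<close>-dimensional normed space \<open>'e\<close>,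
  which plays the role of $\mathbb{R}^n$. The class \<open>euclidean_space\<close> is not used because it
  excludes dimension 0. The atlas need not be maximal.\<close>

record ('p, 'e) charted_space =
  mtop :: "'p topology"
  charts :: "('p set \<times> ('p \<Rightarrow> 'e)) set"

abbreviation points :: "('p, 'e) charted_space \<Rightarrow> 'p set" where
  "points M \<equiv> topspace (mtop M)"

definition smooth_manifold :: "('p, 'e::real_normed_vector) charted_space \<Rightarrow> bool" where
  "smooth_manifold M \<longleftrightarrow>
     (\<exists>B. finite B \<and> span B = (UNIV :: 'e set)) \<and>
     Hausdorff_space (mtop M) \<and> second_countable (mtop M) \<and>
     points M = \<Union> (fst ` charts M) \<and>
     (\<forall>(U, c) \<in> charts M. openin (mtop M) U \<and> open (c ` U) \<and>
        homeomorphic_map (subtopology (mtop M) U) (top_of_set (c ` U)) c) \<and>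
     (\<forall>(U, c) \<in> charts M. \<forall>(U', c') \<in> charts M.
        smooth_on (c ` (U \<inter> U')) (c' \<circ> inv_into U c))"

definition Cr_map ::
  "nat \<Rightarrow> ('p, 'e::real_normed_vector) charted_space \<Rightarrow>
   ('q, 'f::real_normed_vector) charted_space \<Rightarrow> ('p \<Rightarrow> 'q) \<Rightarrow> bool" where
  "Cr_map r M N f \<longleftrightarrow>
     continuous_map (mtop M) (mtop N) f \<and>
     (\<forall>(U, c) \<in> charts M. \<forall>(U', c') \<in> charts N.
        Ck_on r (c ` (U \<inter> f -` U')) (c' \<circ> f \<circ> inv_into U c))"

text \<open>As in \<^const>\<open>BijGroup\<close>, diffeomorphisms are extensional functions, so that equality of
  functions is equality on \<open>points M\<close>.\<close>

definition Diff ::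
  "nat \<Rightarrow> ('p, 'e::real_normed_vector) charted_space \<Rightarrow> ('p \<Rightarrow> 'p) set" where
  "Diff r M = {f \<in> Bij (points M). Cr_map r M M f \<and> Cr_map r M M (inv_into (points M) f)}"

text \<open>The compact-open $C^r$ topology: \<open>Cr_nbhd r M f (U, c) (U', c') K \<epsilon>\<close> consists of those
  \<open>g\<close> whose coordinate representation is \<open>\<epsilon>\<close>-close to that of \<open>f\<close> on \<open>K\<close>, together with
  all derivatives up to order \<open>r\<close> in the operator norm. On compact \<open>M\<close> this is the only
  standard $C^r$ topology.\<close>

definition Cr_nbhd ::
  "nat \<Rightarrow> ('p, 'e::real_normed_vector) charted_space \<Rightarrow> ('p \<Rightarrow> 'p) \<Rightarrow>
   'p set \<times> ('p \<Rightarrow> 'e) \<Rightarrow> 'p set \<times> ('p \<Rightarrow> 'e) \<Rightarrow> 'p set \<Rightarrow> real \<Rightarrow> ('p \<Rightarrow> 'p) set" where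
  "Cr_nbhd r M f = (\<lambda>(U, c) (U', c') K \<epsilon>.
     {g \<in> Diff r M. g ` K \<subseteq> U' \<and>
        (\<forall>x\<in>K. \<forall>vs. length vs \<le> r \<and> (\<forall>v\<in>set vs. norm v \<le> 1) \<longrightarrow>
           norm (deriv_along (c' \<circ> g \<circ> inv_into U c) vs (c x)
                 - deriv_along (c' \<circ> f \<circ> inv_into U c) vs (c x)) < \<epsilon>)})"

definition Cr_topology ::
  "nat \<Rightarrow> ('p, 'e::real_normed_vector) charted_space \<Rightarrow> ('p \<Rightarrow> 'p) topology" where
  "Cr_topology r M = topology_generated_by
     (insert (Diff r M)
       {Cr_nbhd r M f (U, c) (U', c') K \<epsilon> | f U c U' c' K \<epsilon>.
          f \<in> Diff r M \<and> (U, c) \<in> charts M \<and> (U', c') \<in> charts M \<and>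
          compactin (mtop M) K \<and> K \<subseteq> U \<and> f ` K \<subseteq> U' \<and> \<epsilon> > 0})"

section \<open>Jets and frame bundles\<close>

text \<open>The \<open>k\<close>-jet of \<open>f\<close> at \<open>x\<close>, recorded as the collection of all derivatives of order at
  most \<open>k\<close>. Sets of jets carry the topology of pointwise convergence on \<open>'e list\<close>; for
  finite-dimensional \<open>'e\<close> this is the usual topology on a space of tuples of multilinear
  maps.\<close>

definition jet ::
  "nat \<Rightarrow> ('e::real_normed_vector \<Rightarrow> 'f::real_normed_vector) \<Rightarrow> 'e \<Rightarrow> ('e list \<Rightarrow> 'f)" where
  "jet k f x = (\<lambda>vs. if length vs \<le> k then deriv_along f vs x else 0)"

definition origin_diffeos :: "('e::real_normed_vector \<Rightarrow> 'e) set" where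
  "origin_diffeos =
     {f. bij f \<and> smooth_on UNIV f \<and> smooth_on UNIV (inv_into UNIV f) \<and> f 0 = 0}"

definition jet_rep ::
  "nat \<Rightarrow> ('e::real_normed_vector list \<Rightarrow> 'e) \<Rightarrow> ('e \<Rightarrow> 'e)" where
  "jet_rep k \<delta> = (SOME f. f \<in> origin_diffeos \<and> jet k f 0 = \<delta>)"

text \<open>The group $D^k$. By the chain rule the \<open>k\<close>-jet of a composition depends only on the
  \<open>k\<close>-jets of the factors, so the choice of representatives is immaterial.\<close>

definition jet_group :: "nat \<Rightarrow> ('e::real_normed_vector list \<Rightarrow> 'e) monoid" where
  "jet_group k =
     \<lparr>carrier = {jet k f 0 | f. f \<in> origin_diffeos},
      mult = (\<lambda>\<delta> \<delta>'. jet k (jet_rep k \<delta> \<circ> jet_rep k \<delta>') 0),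
      one = jet k id 0\<rparr>"

text \<open>Local \<open>C\<^sup>k\<close> diffeomorphisms from a neighbourhood of 0 to an open subset of \<open>M\<close>. Their
  \<open>k\<close>-jets at 0 are the same as those of smooth local diffeomorphisms, but this class of
  representatives is stable under composition with \<open>C\<^sup>r\<close> diffeomorphisms for \<open>r \<ge> k\<close>.\<close>

definition local_param ::
  "nat \<Rightarrow> ('p, 'e::real_normed_vector) charted_space \<Rightarrow> ('e \<Rightarrow> 'p) \<Rightarrow> bool" where
  "local_param k M u \<longleftrightarrow>
     (\<exists>W. open W \<and> 0 \<in> W \<and> openin (mtop M) (u ` W) \<and>
        homeomorphic_map (top_of_set W) (subtopology (mtop M) (u ` W)) u \<and>
        (\<forall>(U, c) \<in> charts M.
           Ck_on k (W \<inter> u -` U) (c \<circ> u) \<and>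
           Ck_on k (c ` (U \<inter> u ` W)) (inv_into W u \<circ> inv_into U c)))"

definition jet_rel ::
  "nat \<Rightarrow> ('p, 'e::real_normed_vector) charted_space \<Rightarrow> (('e \<Rightarrow> 'p) \<times> ('e \<Rightarrow> 'p)) set" where
  "jet_rel k M = {(u, u'). local_param k M u \<and> local_param k M u' \<and> u 0 = u' 0 \<and>
     (\<forall>(U, c) \<in> charts M. u 0 \<in> U \<longrightarrow> jet k (c \<circ> u) 0 = jet k (c \<circ> u') 0)}"

text \<open>The bundle $P^k(M)$: a \<open>k\<close>-frame is an equivalence class of local parametrizations.\<close>

definition frame_bundle ::
  "nat \<Rightarrow> ('p, 'e::real_normed_vector) charted_space \<Rightarrow> ('e \<Rightarrow> 'p) set set" where
  "frame_bundle k M = {u. local_param k M u} // jet_rel k M"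

text \<open>The bundle topology, generated by the preimages of open sets under the bundle charts
  \<open>[u] \<mapsto> jet k (c \<circ> u) 0\<close>. The base point in a chart is the order 0 part of the jet.\<close>

definition frame_topology ::
  "nat \<Rightarrow> ('p, 'e::real_normed_vector) charted_space \<Rightarrow> ('e \<Rightarrow> 'p) set topology" where
  "frame_topology k M = topology_generated_by
     {{p \<in> frame_bundle k M. \<forall>u\<in>p. u 0 \<in> U \<and> jet k (c \<circ> u) 0 \<in> S} | U c S.
        (U, c) \<in> charts M \<and> open S}"

text \<open>The right action of $D^k$ by precomposition, and the map $g^k$ induced by a
  diffeomorphism. The images under the equivalence relation are single classes.\<close>

definition frame_act ::
  "nat \<Rightarrow> ('p, 'e::real_normed_vector) charted_space \<Rightarrow> ('e \<Rightarrow> 'p) set \<Rightarrow>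
   ('e list \<Rightarrow> 'e) \<Rightarrow> ('e \<Rightarrow> 'p) set" where
  "frame_act k M p \<delta> =
     jet_rel k M `` {u \<circ> f | u f. u \<in> p \<and> f \<in> origin_diffeos \<and> jet k f 0 = \<delta>}"

definition frame_map ::
  "nat \<Rightarrow> ('p, 'e::real_normed_vector) charted_space \<Rightarrow> ('p \<Rightarrow> 'p) \<Rightarrow>
   ('e \<Rightarrow> 'p) set \<Rightarrow> ('e \<Rightarrow> 'p) set" where
  "frame_map k M g p = jet_rel k M `` {g \<circ> u | u. u \<in> p}"

section \<open>Geometric structures\<close>

text \<open>\<open>\<alpha>\<close> is a continuous left action of $D^k$ on \<open>V\<close>. Since $D^k$ acts on frames from the
  right, equivariance of \<open>\<omega>\<close> reads \<open>\<omega>(p \<delta>) = \<delta>\<^sup>-\<^sup>1 \<omega>(p)\<close>.\<close>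

definition geometric_structure ::
  "nat \<Rightarrow> ('p, 'e::real_normed_vector) charted_space \<Rightarrow>
   ('v, 'f::real_normed_vector) charted_space \<Rightarrow>
   (('e list \<Rightarrow> 'e) \<Rightarrow> 'v \<Rightarrow> 'v) \<Rightarrow> (('e \<Rightarrow> 'p) set \<Rightarrow> 'v) \<Rightarrow> bool" where
  "geometric_structure k M V \<alpha> \<omega> \<longleftrightarrow>
     smooth_manifold V \<and>
     group_action (jet_group k) (points V) \<alpha> \<and>
     continuous_map (prod_topology (top_of_set (carrier (jet_group k))) (mtop V)) (mtop V)
       (\<lambda>(\<delta>, v). \<alpha> \<delta> v) \<and>
     continuous_map (frame_topology k M) (mtop V) \<omega> \<and>
     (\<forall>p \<in> frame_bundle k M. \<forall>\<delta> \<in> carrier (jet_group k).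
        \<omega> (frame_act k M p \<delta>) = \<alpha> (inv\<^bsub>jet_group k\<^esub> \<delta>) (\<omega> p))"

definition Aut ::
  "nat \<Rightarrow> nat \<Rightarrow> ('p, 'e::real_normed_vector) charted_space \<Rightarrow>
   (('e \<Rightarrow> 'p) set \<Rightarrow> 'v) \<Rightarrow> ('p \<Rightarrow> 'p) set" where
  "Aut r k M \<omega> = {g \<in> Diff r M. \<forall>p \<in> frame_bundle k M. \<omega> (frame_map k M g p) = \<omega> p}"

text \<open>\<open>\<omega>\<close>, of order \<open>k \<le> r\<close>, is rigid of order \<open>r\<close>. Properness of the action of
  \<open>A = Aut r k M \<omega>\<close> on $P^r(M)$ is properness of \<open>(g, p) \<mapsto> (g p, p)\<close>.\<close>

definition rigid ::
  "nat \<Rightarrow> nat \<Rightarrow> ('p, 'e::real_normed_vector) charted_space \<Rightarrow>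
   (('e \<Rightarrow> 'p) set \<Rightarrow> 'v) \<Rightarrow> bool" where
  "rigid r k M \<omega> \<longleftrightarrow>
     k \<le> r \<and>
     (\<forall>g \<in> Aut r k M \<omega>. \<forall>p \<in> frame_bundle r M.
        frame_map r M g p = p \<longrightarrow> g = (\<lambda>x \<in> points M. x)) \<and>
     proper_map
       (prod_topology (subtopology (Cr_topology r M) (Aut r k M \<omega>)) (frame_topology r M))
       (prod_topology (frame_topology r M) (frame_topology r M))
       (\<lambda>(g, p). (frame_map r M g p, p))"

definition Inn ::
  "nat \<Rightarrow> ('p, 'e::real_normed_vector) charted_space \<Rightarrow>
   ('g, 'x) monoid_scheme \<Rightarrow> ('g \<Rightarrow> 'p \<Rightarrow> 'p) \<Rightarrow> ('p \<Rightarrow> 'p) set" where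
  "Inn r M \<Gamma> \<phi> = {f \<in> Diff r M. \<forall>x \<in> points M. f x \<in> orbit \<Gamma> \<phi> x}"

end

theory Submission
  imports Defs
begin

text \<open>By Baire's theorem a map in \<open>Inn\<close> agrees with elements of \<open>\<Gamma>\<close> on an open dense
  set. There it has the same jets as automorphisms of \<open>\<omega>\<close>, so by continuity of \<open>\<omega>\<close> it is
  itself an automorphism. It agrees with some \<open>\<gamma>\<close> near a point, hence on the frames over
  that point, and freeness of the action on frames forces it to equal \<open>\<gamma>\<close>.\<close>

section \<open>Finite-dimensional normed spaces\<close>

text \<open>Freeness speaks only about automorphisms of \<open>\<omega>\<close>, so a map in
  \<open>Inn\<close> must be known to preserve \<open>\<omega>\<close> on every k-frame before it
  can be compared with the group. Baire is therefore used twice. The first use is local: every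
  nonempty open set of base points contains an open piece on which the map equals a single group
  element, and a given frame is moved in a continuous family until its base point meets such a
  piece. The second use takes all of M as the open set and produces \<open>\<gamma>\<close>. What
  freeness then forces to be the identity is the inverse of \<open>\<gamma>\<close> composed with f,
  which lies in \<open>Inn\<close> again because \<open>\<Gamma>\<close> preserves its own orbits.
  The model space is an arbitrary finite-dimensional normed space, and derivatives are recorded
  direction by direction. Hence coordinates must first be shown bounded, and the chain rule enters
  in a qualitative form: for a fixed outer map, the k-jet of a composite is determined by the k-jet
  of the inner map.\<close>

lemma finite_independent_norm_bound:
  fixes B :: "'e::real_normed_vector set"
  assumes "finite B" "independent B"
  obtains C where "C > 0" "\<And>a. (\<Sum>b\<in>B. \<bar>a b\<bar>) \<le> C * norm (\<Sum>b\<in>B. a b *\<^sub>R b)"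
proof (cases "B = {}")
  case True
  then show ?thesis using that[of 1] by auto
next
  case False
  \<comment> \<open>\<open>K\<close> is the unit sphere of the l1 norm on coefficients. Coefficients
    are functions on the whole type, so those off \<open>B\<close> are pinned to 0; the box is then
    compact by Tychonoff. The minimum of the norm on \<open>K\<close> is positive by independence,
    and its reciprocal is the constant.\<close>
  define X where "X = (\<lambda>b::'e. if b \<in> B then {-1..1} else {0::real})"
  define K where "K = (\<Pi>\<^sub>E b\<in>UNIV. X b) \<inter> {a. (\<Sum>b\<in>B. \<bar>a b\<bar>) = 1}"
  have "compactin (product_topology (\<lambda>i::'e. euclidean) UNIV) (\<Pi>\<^sub>E b\<in>UNIV. X b)"
    unfolding compactin_PiE by (auto simp: X_def)
  then have "compact (\<Pi>\<^sub>E b\<in>UNIV. X b)"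
    by (simp add: euclidean_product_topology)
  moreover have "closed {a::'e\<Rightarrow>real. (\<Sum>b\<in>B. \<bar>a b\<bar>) = 1}"
    by (intro closed_Collect_eq continuous_intros continuous_on_product_then_coordinatewise)
  ultimately have "compact K"
    unfolding K_def by blast
  moreover have "K \<noteq> {}"
  proof -
    obtain c where "c \<in> B" using False by blast
    then have "(\<lambda>b. if b = c then 1 else 0) \<in> K"
      using assms(1) by (auto simp: K_def X_def if_distrib cong: if_cong)
    then show ?thesis by blast
  qed
  moreover have "continuous_on K (\<lambda>a. norm (\<Sum>b\<in>B. a b *\<^sub>R b))"
    by (intro continuous_intros continuous_on_product_then_coordinatewise)
  ultimately obtain m where m: "m \<in> K"
      "\<And>a. a \<in> K \<Longrightarrow> norm (\<Sum>b\<in>B. m b *\<^sub>R b) \<le> norm (\<Sum>b\<in>B. a b *\<^sub>R b)"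
    by (meson continuous_attains_inf)
  define \<mu> where "\<mu> = norm (\<Sum>b\<in>B. m b *\<^sub>R b)"
  have "(\<Sum>b\<in>B. m b *\<^sub>R b) \<noteq> 0"
  proof
    assume "(\<Sum>b\<in>B. m b *\<^sub>R b) = 0"
    then have "\<forall>b\<in>B. m b = 0"
      using assms independent_explicit_finite_subsets by (metis subset_refl)
    then show False using m(1) by (simp add: K_def)
  qed
  then have \<mu>: "\<mu> > 0" by (simp add: \<mu>_def)
  have "(\<Sum>b\<in>B. \<bar>a b\<bar>) \<le> (1/\<mu>) * norm (\<Sum>b\<in>B. a b *\<^sub>R b)" for a
  proof (cases "(\<Sum>b\<in>B. \<bar>a b\<bar>) = 0")
    case True
    then show ?thesis using \<mu> by simp
  next
    case False
    define s where "s = (\<Sum>b\<in>B. \<bar>a b\<bar>)"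
    have s: "s > 0" using False unfolding s_def by (simp add: order_less_le sum_nonneg)
    \<comment> \<open>Rescaling to l1 norm 1 and cutting off outside \<open>B\<close> puts the
      coefficients into \<open>K\<close>.\<close>
    define a' where "a' = (\<lambda>b. if b \<in> B then a b / s else 0)"
    have "\<bar>a b\<bar> \<le> s" if "b \<in> B" for b
      unfolding s_def using assms(1) that by (intro member_le_sum) auto
    then have "\<bar>a b / s\<bar> \<le> 1" if "b \<in> B" for b
      using s that by (simp add: abs_divide)
    then have "-1 \<le> a b / s \<and> a b / s \<le> 1" if "b \<in> B" for b
      using that by (metis abs_le_iff minus_le_iff)
    then have "a' \<in> (\<Pi>\<^sub>E b\<in>UNIV. X b)"
      by (auto simp: X_def a'_def)
    moreover have "(\<Sum>b\<in>B. \<bar>a' b\<bar>) = (\<Sum>b\<in>B. \<bar>a b\<bar> / s)"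
      using s by (intro sum.cong) (auto simp: a'_def abs_divide)
    then have "(\<Sum>b\<in>B. \<bar>a' b\<bar>) = 1"
      using s by (simp add: s_def[symmetric] sum_divide_distrib[symmetric])
    ultimately have "\<mu> \<le> norm (\<Sum>b\<in>B. a' b *\<^sub>R b)"
      using m(2) by (auto simp: \<mu>_def K_def)
    also have "(\<Sum>b\<in>B. a' b *\<^sub>R b) = (\<Sum>b\<in>B. (1/s) *\<^sub>R (a b *\<^sub>R b))"
      by (intro sum.cong) (auto simp: a'_def)
    also have "norm \<dots> = norm (\<Sum>b\<in>B. a b *\<^sub>R b) / s"
      unfolding scaleR_sum_right[symmetric] norm_scaleR using s by simp
    finally show ?thesis
      using s \<mu> by (simp add: field_simps s_def[symmetric])
  qed
  then show ?thesis using that[of "1/\<mu>"] \<mu> by simp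
qed

text \<open>The coordinates belong to a basis extracted from the spanning set. The preceding
  estimate makes them bounded, which is what lets them commute with derivatives; for
  \<open>b\<close> outside the basis the coordinate is 0.\<close>

lemma finite_span_coordinates:
  assumes "\<exists>B. finite B \<and> span B = (UNIV :: 'e::real_normed_vector set)"
  obtains B and coord :: "'e::real_normed_vector \<Rightarrow> 'e \<Rightarrow> real"
  where "finite B" "\<And>b. bounded_linear (coord b)" "\<And>x. x = (\<Sum>b\<in>B. coord b x *\<^sub>R b)"
proof -
  obtain B0 where B0: "finite B0" "span B0 = (UNIV :: 'e set)"
    using assms by blast
  obtain B where B: "B \<subseteq> B0" "independent B" "B0 \<subseteq> span B"
    using maximal_independent_subset[of B0] by blast
  have fin: "finite B" using B(1) B0(1) finite_subset by blast
  have sp: "span B = UNIV"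
    using B(3) B0(2) by (metis span_mono span_span top.extremum_uniqueI)
  obtain C where C: "C > 0" "\<And>a. (\<Sum>b\<in>B. \<bar>a b\<bar>) \<le> C * norm (\<Sum>b\<in>B. a b *\<^sub>R b)"
    using finite_independent_norm_bound[OF fin B(2)] by blast
  have rep: "(\<Sum>b\<in>B. representation B x b *\<^sub>R b) = x" for x
    using sum_representation_eq[OF B(2) _ fin subset_refl] sp by simp
  have "bounded_linear (\<lambda>x. representation B x b)" for b
  proof (rule bounded_linear_intro[where K = C])
    show "representation B (x + y) b = representation B x b + representation B y b" for x y
      using representation_add[OF B(2)] sp by simp
    show "representation B (r *\<^sub>R x) b = r *\<^sub>R representation B x b" for r x
      using representation_scale[OF B(2)] sp by simp
    show "norm (representation B x b) \<le> norm x * C" for x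
    proof (cases "b \<in> B")
      case True
      then have "\<bar>representation B x b\<bar> \<le> (\<Sum>b\<in>B. \<bar>representation B x b\<bar>)"
        using fin by (intro member_le_sum) auto
      also have "\<dots> \<le> C * norm x" using C(2)[of "representation B x"] by (simp add: rep)
      finally show ?thesis by (simp add: mult.commute)
    next
      case False
      then have "representation B x b = 0" using representation_ne_zero by blast
      then show ?thesis using C(1) by simp
    qed
  qed
  then show ?thesis
    using that[of B "\<lambda>b x. representation B x b"] fin rep by simp
qed

section \<open>Calculus of order $k$\<close>

text \<open>Points of non-differentiability are covered too: \<open>frechet_derivative\<close> is a
  choice from the predicate \<open>has_derivative\<close>, and equal predicates give equal
  choices.\<close>

lemma frechet_derivative_cong_open:
  assumes "open S" "x \<in> S" "\<And>y. y \<in> S \<Longrightarrow> f y = g y"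
  shows "frechet_derivative f (at x) = frechet_derivative g (at x)"
proof -
  have "(f has_derivative D) (at x) \<longleftrightarrow> (g has_derivative D) (at x)" for D
    using assms has_derivative_transform_within_open[of _ D x UNIV S]
    by (metis (no_types, lifting))
  then show ?thesis by (simp add: frechet_derivative_def)
qed

lemma frechet_derivative_shift:
  "frechet_derivative (\<lambda>x. f (x + t)) (at x) = frechet_derivative f (at (x + t))"
proof -
  have 1: "((\<lambda>x. f (x + t)) has_derivative D) (at x)"
    if "(f has_derivative D) (at (x + t))" for D and f :: "'a \<Rightarrow> 'b" and x t
    using has_derivative_compose[of "\<lambda>x. x + t" "\<lambda>h. h" x UNIV f D] that
    by (simp add: has_derivative_add_const)
  have "((\<lambda>x. f (x + t)) has_derivative D) (at x) \<longleftrightarrow> (f has_derivative D) (at (x + t))" for D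
    \<comment> \<open>The converse is the same implication for the translated function, shifted back
      by \<open>- t\<close>.\<close>
    using 1[of f D x t] 1[of "\<lambda>x. f (x + t)" D "x + t" "- t"] by auto
  then show ?thesis by (simp add: frechet_derivative_def)
qed

lemma deriv_along_cong_open:
  assumes "open S" "x \<in> S" "\<And>y. y \<in> S \<Longrightarrow> f y = g y"
  shows "deriv_along f vs x = deriv_along g vs x"
  using assms(3)
proof (induction vs arbitrary: f g)
  case Nil
  then show ?case using assms(2) by simp
next
  case (Cons v vs)
  show ?case
    using Cons.IH[of "\<lambda>x. frechet_derivative f (at x) v" "\<lambda>x. frechet_derivative g (at x) v"]
      frechet_derivative_cong_open[OF assms(1) _ Cons.prems] by simp
qed

lemma deriv_along_shift:
  "deriv_along (\<lambda>x. f (x + t)) vs x = deriv_along f vs (x + t)"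
proof (induction vs arbitrary: f)
  case (Cons v vs)
  show ?case
    using Cons.IH[of "\<lambda>x. frechet_derivative f (at x) v"]
    by (simp add: frechet_derivative_shift)
qed simp

lemma jet_cong_open:
  assumes "open S" "x \<in> S" "\<And>y. y \<in> S \<Longrightarrow> f y = g y"
  shows "jet k f x = jet k g x"
  using deriv_along_cong_open[OF assms] by (simp add: jet_def fun_eq_iff)

lemma jet_shift: "jet k (\<lambda>x. f (x + t)) x = jet k f (x + t)"
  by (simp add: jet_def deriv_along_shift fun_eq_iff)

lemma jet_eq_iff:
  "jet k f x = jet k g x \<longleftrightarrow>
     (\<forall>vs. length vs \<le> k \<longrightarrow> deriv_along f vs x = deriv_along g vs x)"
  by (auto simp: jet_def fun_eq_iff)

lemma jet_eq_imp_eq: "jet k f x = jet k g x \<Longrightarrow> f x = g x"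
  unfolding jet_eq_iff by (metis deriv_along.simps(1) le0 list.size(3))

lemma jet_eq_mono: "jet k f x = jet k g x \<Longrightarrow> j \<le> k \<Longrightarrow> jet j f x = jet j g x"
  unfolding jet_eq_iff by (meson le_trans)

text \<open>Splitting off the first direction matches the recursion of \<open>deriv_along\<close>
  and \<open>Ck_on\<close>, and turns statements about jets into inductions on k.\<close>

lemma jet_Suc_eq_iff:
  "jet (Suc k) f x = jet (Suc k) g x \<longleftrightarrow> f x = g x \<and>
     (\<forall>v. jet k (\<lambda>y. frechet_derivative f (at y) v) x
        = jet k (\<lambda>y. frechet_derivative g (at y) v) x)"
proof (intro iffI conjI allI)
  assume *: "f x = g x \<and> (\<forall>v. jet k (\<lambda>y. frechet_derivative f (at y) v) x
        = jet k (\<lambda>y. frechet_derivative g (at y) v) x)"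
  have "deriv_along f vs x = deriv_along g vs x" if "length vs \<le> Suc k" for vs
    using * that by (cases vs) (auto simp: jet_eq_iff)
  then show "jet (Suc k) f x = jet (Suc k) g x" by (simp add: jet_eq_iff)
next
  assume *: "jet (Suc k) f x = jet (Suc k) g x"
  then show "f x = g x" by (rule jet_eq_imp_eq)
  fix v
  have "deriv_along f (v # vs) x = deriv_along g (v # vs) x" if "length vs \<le> k" for vs
    using * that unfolding jet_eq_iff by (metis Suc_le_mono length_Cons)
  then show "jet k (\<lambda>y. frechet_derivative f (at y) v) x
        = jet k (\<lambda>y. frechet_derivative g (at y) v) x"
    by (simp add: jet_eq_iff)
qed

lemma frechet_derivative_eq:
  "(f has_derivative D) (at x) \<Longrightarrow> frechet_derivative f (at x) = D"
  by (metis frechet_derivative_at)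

text \<open>Allows the derivatives to be given by explicit formulas (Leibniz, chain rule) on a
  neighbourhood, where they may replace \<open>frechet_derivative\<close> without changing the
  jet.\<close>

lemma jet_Suc_eqI:
  assumes "open S" "x \<in> S" "f x = g x"
    and "\<And>y. y \<in> S \<Longrightarrow> (f has_derivative D y) (at y)"
    and "\<And>y. y \<in> S \<Longrightarrow> (g has_derivative E y) (at y)"
    and "\<And>v. jet k (\<lambda>y. D y v) x = jet k (\<lambda>y. E y v) x"
  shows "jet (Suc k) f x = jet (Suc k) g x"
  unfolding jet_Suc_eq_iff
proof (intro conjI allI)
  fix v
  have "jet k (\<lambda>y. frechet_derivative f (at y) v) x = jet k (\<lambda>y. D y v) x"
    using assms(1,2) by (rule jet_cong_open) (simp add: frechet_derivative_eq[OF assms(4)])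
  moreover have "jet k (\<lambda>y. frechet_derivative g (at y) v) x = jet k (\<lambda>y. E y v) x"
    using assms(1,2) by (rule jet_cong_open) (simp add: frechet_derivative_eq[OF assms(5)])
  ultimately show "jet k (\<lambda>y. frechet_derivative f (at y) v) x
        = jet k (\<lambda>y. frechet_derivative g (at y) v) x"
    using assms(6) by simp
qed fact

section \<open>Closure properties of maps of class C^k\<close>

lemma Ck_on_cong:
  assumes "open S" "\<And>y. y \<in> S \<Longrightarrow> f y = g y" "Ck_on k S f"
  shows "Ck_on k S g"
  using assms(2,3)
proof (induction k arbitrary: f g)
  case 0
  then show ?case by (metis Ck_on.simps(1) continuous_on_cong)
next
  case (Suc k)
  have "g differentiable (at x)" if "x \<in> S" for x
    using Suc.prems that assms(1) unfolding differentiable_def Ck_on.simps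
    by (meson has_derivative_transform_within_open)
  moreover have "Ck_on k S (\<lambda>x. frechet_derivative g (at x) v)" for v
    using Suc.IH[of "\<lambda>x. frechet_derivative f (at x) v" "\<lambda>x. frechet_derivative g (at x) v"]
      frechet_derivative_cong_open[OF assms(1) _ Suc.prems(1)] Suc.prems(2) by simp
  ultimately show ?case by simp
qed

lemma Ck_on_subset: "Ck_on k S f \<Longrightarrow> T \<subseteq> S \<Longrightarrow> Ck_on k T f"
  by (induction k arbitrary: f) (auto intro: continuous_on_subset)

lemma Ck_on_SucD: "Ck_on (Suc k) S f \<Longrightarrow> Ck_on k S f"
proof (induction k arbitrary: f)
  case 0
  then show ?case
    by (simp add: continuous_at_imp_continuous_on differentiable_imp_continuous_within)
qed (metis Ck_on.simps(2))

lemma Ck_on_mono: "Ck_on k S f \<Longrightarrow> j \<le> k \<Longrightarrow> Ck_on j S f"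
  by (rotate_tac, induction rule: dec_induct) (use Ck_on_SucD in blast)+

lemma Ck_on_imp_continuous_on: "Ck_on k S f \<Longrightarrow> continuous_on S f"
  using Ck_on_mono[of k S f 0] by simp

lemma Ck_on_locally:
  assumes "\<And>x. x \<in> S \<Longrightarrow> \<exists>T. open T \<and> x \<in> T \<and> Ck_on k T f"
  shows "Ck_on k S f"
  using assms
proof (induction k arbitrary: f)
  case 0
  then show ?case
    by (metis Ck_on.simps(1) continuous_at_imp_continuous_on continuous_on_eq_continuous_at)
next
  case (Suc k)
  show ?case
    unfolding Ck_on.simps
  proof (intro conjI ballI allI)
    show "f differentiable at x" if "x \<in> S" for x
      using Suc.prems[OF that] by auto
    show "Ck_on k S (\<lambda>x. frechet_derivative f (at x) v)" for v
      using Suc.prems by (intro Suc.IH) (metis Ck_on.simps(2))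
  qed
qed

lemma Ck_on_SucI:
  assumes "open S" "\<And>x. x \<in> S \<Longrightarrow> (f has_derivative D x) (at x)"
    and "\<And>v. Ck_on k S (\<lambda>x. D x v)"
  shows "Ck_on (Suc k) S f"
  unfolding Ck_on.simps
proof (intro conjI ballI allI)
  show "f differentiable at x" if "x \<in> S" for x
    using assms(2) that differentiable_def by blast
  show "Ck_on k S (\<lambda>x. frechet_derivative f (at x) v)" for v
    using assms(1) _ assms(3)[of v] by (rule Ck_on_cong) (simp add: frechet_derivative_eq[OF assms(2)])
qed

lemma Ck_on_has_derivative:
  "Ck_on (Suc k) S f \<Longrightarrow> x \<in> S \<Longrightarrow> (f has_derivative frechet_derivative f (at x)) (at x)"
  by (simp add: frechet_derivative_works)

lemma Ck_on_const: "open S \<Longrightarrow> Ck_on k S (\<lambda>x. c)"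
  by (induction k arbitrary: c) (auto simp: continuous_on_const)

lemma Ck_on_bounded_linear_compose:
  assumes "open S" "bounded_linear L" "Ck_on k S f"
  shows "Ck_on k S (\<lambda>x. L (f x))"
  using assms(3)
proof (induction k arbitrary: f)
  case 0
  then show ?case using assms(2) by (simp add: bounded_linear.continuous_on)
next
  case (Suc k)
  show ?case
    using assms(1)
  proof (rule Ck_on_SucI)
    show "((\<lambda>x. L (f x)) has_derivative (\<lambda>v. L (frechet_derivative f (at x) v))) (at x)"
      if "x \<in> S" for x
      using bounded_linear.has_derivative[OF assms(2)] Ck_on_has_derivative[OF Suc.prems that] .
    show "Ck_on k S (\<lambda>x. L (frechet_derivative f (at x) v))" for v
      using Suc by simp
  qed
qed

lemma Ck_on_add:
  assumes "open S" "Ck_on k S f" "Ck_on k S g"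
  shows "Ck_on k S (\<lambda>x. f x + g x)"
  using assms(2,3)
proof (induction k arbitrary: f g)
  case 0
  then show ?case by (simp add: continuous_on_add)
next
  case (Suc k)
  show ?case
    using assms(1)
  proof (rule Ck_on_SucI)
    show "((\<lambda>x. f x + g x) has_derivative
        (\<lambda>v. frechet_derivative f (at x) v + frechet_derivative g (at x) v)) (at x)"
      if "x \<in> S" for x
      by (intro has_derivative_add Suc.prems[THEN Ck_on_has_derivative, OF that])
    show "Ck_on k S (\<lambda>x. frechet_derivative f (at x) v + frechet_derivative g (at x) v)" for v
      using Suc by simp
  qed
qed

lemma Ck_on_sum:
  assumes "open S" "\<And>i. i \<in> I \<Longrightarrow> Ck_on k S (f i)"
  shows "Ck_on k S (\<lambda>x. \<Sum>i\<in>I. f i x)"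
  using assms(2)
  by (induction I rule: infinite_finite_induct) (auto intro: Ck_on_const Ck_on_add assms(1))

lemma Ck_on_scaleR:
  fixes \<phi> :: "'e::real_normed_vector \<Rightarrow> real"
  assumes "open S" "Ck_on k S \<phi>" "Ck_on k S g"
  shows "Ck_on k S (\<lambda>x. \<phi> x *\<^sub>R g x)"
  using assms(2,3)
proof (induction k arbitrary: \<phi> g)
  case 0
  then show ?case by (simp add: continuous_on_scaleR)
next
  case (Suc k)
  show ?case
    using assms(1)
  proof (rule Ck_on_SucI)
    show "((\<lambda>x. \<phi> x *\<^sub>R g x) has_derivative
        (\<lambda>v. \<phi> x *\<^sub>R frechet_derivative g (at x) v + frechet_derivative \<phi> (at x) v *\<^sub>R g x)) (at x)"
      if "x \<in> S" for x
      by (intro has_derivative_scaleR Suc.prems[THEN Ck_on_has_derivative, OF that])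
    show "Ck_on k S (\<lambda>x. \<phi> x *\<^sub>R frechet_derivative g (at x) v
        + frechet_derivative \<phi> (at x) v *\<^sub>R g x)" for v
      using Suc by (intro Ck_on_add assms(1) Suc.IH) (auto intro: Ck_on_SucD)
  qed
qed

lemma Ck_on_shift:
  "Ck_on k S f \<Longrightarrow> Ck_on k ((\<lambda>x. x - t) ` S) (\<lambda>x. f (x + t))"
proof (induction k arbitrary: f)
  case 0
  then show ?case
    by (auto intro!: continuous_intros elim!: continuous_on_compose2)
next
  case (Suc k)
  have "(\<lambda>x. f (x + t)) differentiable at (x - t)" if "x \<in> S" for x
    using differentiable_chain_at[of "\<lambda>x. x + t" "x - t" f] Suc.prems that
    by (simp add: comp_def)
  then show ?case
    using Suc by (auto simp: frechet_derivative_shift)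
qed

text \<open>Expanding \<open>D (g \<circ> f) x v = Dg (f x) (Df x v)\<close> in coordinates of \<open>Df x v\<close> reduces the
  induction step to sums and products, at the same type.\<close>

lemma has_derivative_compose_coordinates:
  assumes "\<And>b. bounded_linear (coord b)" and x: "\<And>x. x = (\<Sum>b\<in>B. coord b x *\<^sub>R b)"
    and f: "(f has_derivative f') (at x)" and g: "(g has_derivative g') (at (f x))"
  shows "((\<lambda>x. g (f x)) has_derivative (\<lambda>v. \<Sum>b\<in>B. coord b (f' v) *\<^sub>R g' b)) (at x)"
proof -
  have "linear g'" using g has_derivative_linear by blast
  then have "g' w = (\<Sum>b\<in>B. coord b w *\<^sub>R g' b)" for w
    by (subst x[of w]) (simp only: linear_sum[OF \<open>linear g'\<close>] linear_cmul[OF \<open>linear g'\<close>])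
  then show ?thesis
    by (intro has_derivative_eq_rhs[OF has_derivative_compose[OF f g]] ext)
qed

lemma Ck_on_compose:
  fixes f :: "'d::real_normed_vector \<Rightarrow> 'e::real_normed_vector"
    and g :: "'e \<Rightarrow> 'f::real_normed_vector"
  assumes fd: "\<exists>B. finite B \<and> span B = (UNIV :: 'e set)"
    and "open S" "Ck_on k S f" "Ck_on k T g" "\<And>x. x \<in> S \<Longrightarrow> f x \<in> T"
  shows "Ck_on k S (\<lambda>x. g (f x))"
proof -
  obtain B and coord :: "'e \<Rightarrow> 'e \<Rightarrow> real"
    where bl: "\<And>b. bounded_linear (coord b)" and x: "\<And>x. x = (\<Sum>b\<in>B. coord b x *\<^sub>R b)"
    using finite_span_coordinates[OF fd] by metis
  show ?thesis
    using assms(3,4)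
  \<comment> \<open>Only \<open>g\<close> varies: the inner map stays \<open>f\<close>, while the
    outer one becomes a directional derivative of \<open>g\<close> in a basis direction.\<close>
  proof (induction k arbitrary: g)
    case 0
    then show ?case using assms(5) by (auto elim!: continuous_on_compose2)
  next
    case (Suc k)
    show ?case
      using assms(2)
    proof (rule Ck_on_SucI)
      show "((\<lambda>x. g (f x)) has_derivative (\<lambda>v. \<Sum>b\<in>B. coord b (frechet_derivative f (at x) v)
          *\<^sub>R frechet_derivative g (at (f x)) b)) (at x)" if "x \<in> S" for x
        by (intro has_derivative_compose_coordinates bl x Ck_on_has_derivative[OF Suc.prems(1)]
            Ck_on_has_derivative[OF Suc.prems(2)] that assms(5))
      show "Ck_on k S (\<lambda>x. \<Sum>b\<in>B. coord b (frechet_derivative f (at x) v)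
          *\<^sub>R frechet_derivative g (at (f x)) b)" for v
      proof (intro Ck_on_sum Ck_on_scaleR assms(2))
        show "Ck_on k S (\<lambda>x. coord b (frechet_derivative f (at x) v))" for b
          using Suc.prems(1) by (intro Ck_on_bounded_linear_compose[OF assms(2) bl]) simp
        show "Ck_on k S (\<lambda>x. frechet_derivative g (at (f x)) b)" for b
          using Suc.prems Ck_on_SucD[OF Suc.prems(1)] by (intro Suc.IH) auto
      qed
    qed
  qed
qed

section \<open>Jets of sums, products and composites\<close>

lemma deriv_along_bounded_linear_compose:
  assumes "open S" "x \<in> S" "bounded_linear L" "Ck_on k S f" "length vs \<le> k"
  shows "deriv_along (\<lambda>x. L (f x)) vs x = L (deriv_along f vs x)"
  using assms(4,5)
proof (induction vs arbitrary: f k)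
  case (Cons v vs)
  then obtain j where k: "k = Suc j" "length vs \<le> j" by (cases k) auto
  have "frechet_derivative (\<lambda>x. L (f x)) (at y) v = L (frechet_derivative f (at y) v)"
    if "y \<in> S" for y
    using frechet_derivative_eq[OF bounded_linear.has_derivative[OF assms(3)
          Ck_on_has_derivative[OF Cons.prems(1)[unfolded k(1)] that]]] by simp
  then have "deriv_along (\<lambda>x. L (f x)) (v # vs) x
      = deriv_along (\<lambda>x. L (frechet_derivative f (at x) v)) vs x"
    unfolding deriv_along.simps by (rule deriv_along_cong_open[OF assms(1,2)])
  also have "\<dots> = L (deriv_along f (v # vs) x)"
    using Cons.IH[of j "\<lambda>x. frechet_derivative f (at x) v"] Cons.prems(1) k by simp
  finally show ?case .
qed simp

lemma jet_bounded_linear_cong: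
  assumes "open S" "x \<in> S" "bounded_linear L" "Ck_on k S f" "Ck_on k S g"
    and "jet k f x = jet k g x"
  shows "jet k (\<lambda>x. L (f x)) x = jet k (\<lambda>x. L (g x)) x"
  using assms(6) deriv_along_bounded_linear_compose[OF assms(1-3,4)]
    deriv_along_bounded_linear_compose[OF assms(1-3,5)]
  by (simp add: jet_eq_iff)

lemma deriv_along_add:
  assumes "open S" "x \<in> S" "Ck_on k S f" "Ck_on k S g" "length vs \<le> k"
  shows "deriv_along (\<lambda>x. f x + g x) vs x = deriv_along f vs x + deriv_along g vs x"
  using assms(3-)
proof (induction vs arbitrary: f g k)
  case (Cons v vs)
  then obtain j where k: "k = Suc j" "length vs \<le> j" by (cases k) auto
  have "frechet_derivative (\<lambda>x. f x + g x) (at y) v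
      = frechet_derivative f (at y) v + frechet_derivative g (at y) v" if "y \<in> S" for y
    using frechet_derivative_eq[OF has_derivative_add[OF
          Cons.prems(1,2)[unfolded k(1), THEN Ck_on_has_derivative, OF that]]] by simp
  then have "deriv_along (\<lambda>x. f x + g x) (v # vs) x
      = deriv_along (\<lambda>x. frechet_derivative f (at x) v + frechet_derivative g (at x) v) vs x"
    unfolding deriv_along.simps by (rule deriv_along_cong_open[OF assms(1,2)])
  also have "\<dots> = deriv_along f (v # vs) x + deriv_along g (v # vs) x"
    using Cons.IH[of j "\<lambda>x. frechet_derivative f (at x) v" "\<lambda>x. frechet_derivative g (at x) v"]
      Cons.prems(1,2) k by simp
  finally show ?case .
qed simp

lemma jet_add_cong:
  assumes "open S" "x \<in> S" "Ck_on k S f" "Ck_on k S f'" "Ck_on k S g" "Ck_on k S g'"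
    and "jet k f x = jet k f' x" "jet k g x = jet k g' x"
  shows "jet k (\<lambda>x. f x + g x) x = jet k (\<lambda>x. f' x + g' x) x"
  using assms(7,8) deriv_along_add[OF assms(1,2,3,5)] deriv_along_add[OF assms(1,2,4,6)]
  by (simp add: jet_eq_iff)

lemma jet_sum_cong:
  assumes "open S" "x \<in> S" "\<And>i. i \<in> I \<Longrightarrow> Ck_on k S (f i)" "\<And>i. i \<in> I \<Longrightarrow> Ck_on k S (g i)"
    and "\<And>i. i \<in> I \<Longrightarrow> jet k (f i) x = jet k (g i) x"
  shows "jet k (\<lambda>x. \<Sum>i\<in>I. f i x) x = jet k (\<lambda>x. \<Sum>i\<in>I. g i x) x"
  using assms(3-)
proof (induction I rule: infinite_finite_induct)
  case (insert i I)
  then show ?case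
    by (simp add: jet_add_cong[OF assms(1,2)] Ck_on_sum[OF assms(1)])
qed simp_all

text \<open>A Leibniz rule without the formula. Each of the two terms of the first derivative is a
  product of one factor with a derivative of the other, so the induction hypothesis applies to both
  at order k.\<close>

lemma jet_scaleR_cong:
  fixes \<phi> \<psi> :: "'e::real_normed_vector \<Rightarrow> real"
  assumes "open S" "x \<in> S" "Ck_on k S \<phi>" "Ck_on k S \<psi>" "Ck_on k S f" "Ck_on k S g"
    and "jet k \<phi> x = jet k \<psi> x" "jet k f x = jet k g x"
  shows "jet k (\<lambda>x. \<phi> x *\<^sub>R f x) x = jet k (\<lambda>x. \<psi> x *\<^sub>R g x) x"
  using assms(3-)
proof (induction k arbitrary: \<phi> \<psi> f g)
  case 0
  then show ?case by (simp add: jet_eq_iff)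
next
  case (Suc k)
  note C = Suc.prems(1-4)
  note c = C[THEN Ck_on_SucD]
  let ?D = "frechet_derivative"
  have d: "Ck_on k S (\<lambda>x. ?D \<phi> (at x) v)" "Ck_on k S (\<lambda>x. ?D \<psi> (at x) v)"
    "Ck_on k S (\<lambda>x. ?D f (at x) v)" "Ck_on k S (\<lambda>x. ?D g (at x) v)" for v
    using C by auto
  have J: "jet k \<phi> x = jet k \<psi> x" "jet k f x = jet k g x"
    using Suc.prems(5,6) jet_eq_mono le_SucI order_refl by blast+
  have DJ: "jet k (\<lambda>x. ?D \<phi> (at x) v) x = jet k (\<lambda>x. ?D \<psi> (at x) v) x"
    "jet k (\<lambda>x. ?D f (at x) v) x = jet k (\<lambda>x. ?D g (at x) v) x" for v
    using Suc.prems(5,6) by (auto simp: jet_Suc_eq_iff)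
  show ?case
    using assms(1,2)
  proof (rule jet_Suc_eqI)
    show "\<phi> x *\<^sub>R f x = \<psi> x *\<^sub>R g x"
      using Suc.prems(5,6)[THEN jet_eq_imp_eq] by simp
    show "((\<lambda>x. \<phi> x *\<^sub>R f x) has_derivative
        (\<lambda>v. \<phi> y *\<^sub>R ?D f (at y) v + ?D \<phi> (at y) v *\<^sub>R f y)) (at y)" if "y \<in> S" for y
      by (intro has_derivative_scaleR C[THEN Ck_on_has_derivative, OF that])
    show "((\<lambda>x. \<psi> x *\<^sub>R g x) has_derivative
        (\<lambda>v. \<psi> y *\<^sub>R ?D g (at y) v + ?D \<psi> (at y) v *\<^sub>R g y)) (at y)" if "y \<in> S" for y
      by (intro has_derivative_scaleR C[THEN Ck_on_has_derivative, OF that])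
    fix v
    have "jet k (\<lambda>y. \<phi> y *\<^sub>R ?D f (at y) v) x = jet k (\<lambda>y. \<psi> y *\<^sub>R ?D g (at y) v) x"
      "jet k (\<lambda>y. ?D \<phi> (at y) v *\<^sub>R f y) x = jet k (\<lambda>y. ?D \<psi> (at y) v *\<^sub>R g y) x"
      by (rule Suc.IH; fact c d J DJ)+
    then show "jet k (\<lambda>y. \<phi> y *\<^sub>R ?D f (at y) v + ?D \<phi> (at y) v *\<^sub>R f y) x
        = jet k (\<lambda>y. \<psi> y *\<^sub>R ?D g (at y) v + ?D \<psi> (at y) v *\<^sub>R g y) x"
      using c d by (intro jet_add_cong[OF assms(1,2)] Ck_on_scaleR[OF assms(1)])
  qed
qed

text \<open>The qualitative content of Faa di Bruno's formula. The derivative of the composite is a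
  sum of coordinates of \<open>Df\<close> times directional derivatives of \<open>F\<close> along
  the inner map; the latter have equal k-jets by induction, with \<open>F\<close> replaced by its
  derivative. This is what makes the action of diffeomorphisms on frames well defined.\<close>

lemma jet_compose_cong:
  fixes f g :: "'d::real_normed_vector \<Rightarrow> 'e::real_normed_vector"
    and F :: "'e \<Rightarrow> 'f::real_normed_vector"
  assumes fd: "\<exists>B. finite B \<and> span B = (UNIV :: 'e set)"
    and S: "open S" "x \<in> S" and fg: "Ck_on k S f" "Ck_on k S g"
    and F: "Ck_on k T F" and T: "\<And>x. x \<in> S \<Longrightarrow> f x \<in> T" "\<And>x. x \<in> S \<Longrightarrow> g x \<in> T"
    and J: "jet k f x = jet k g x"
  shows "jet k (\<lambda>x. F (f x)) x = jet k (\<lambda>x. F (g x)) x"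
proof -
  obtain B and coord :: "'e \<Rightarrow> 'e \<Rightarrow> real"
    where bl: "\<And>b. bounded_linear (coord b)" and x: "\<And>x. x = (\<Sum>b\<in>B. coord b x *\<^sub>R b)"
    using finite_span_coordinates[OF fd] by metis
  show ?thesis
    using fg F J
  proof (induction k arbitrary: F)
    case 0
    then show ?case by (simp add: jet_eq_iff)
  next
    case (Suc k)
    let ?D = "frechet_derivative"
    have d: "Ck_on k S (\<lambda>x. ?D f (at x) v)" "Ck_on k S (\<lambda>x. ?D g (at x) v)"
      "Ck_on k T (\<lambda>x. frechet_derivative F (at x) b)" for v b
      using Suc.prems by auto
    note c = Suc.prems(1,2)[THEN Ck_on_SucD]
    have c': "Ck_on k S (\<lambda>y. coord b (?D f (at y) v))" "Ck_on k S (\<lambda>y. coord b (?D g (at y) v))"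
      "Ck_on k S (\<lambda>y. frechet_derivative F (at (f y)) b)" "Ck_on k S (\<lambda>y. frechet_derivative F (at (g y)) b)" for b v
      using c d T by (auto intro!: Ck_on_bounded_linear_compose[OF S(1) bl]
          Ck_on_compose[OF fd S(1) _ d(3)])
    have J: "jet k f x = jet k g x"
      using Suc.prems(4) jet_eq_mono le_SucI order_refl by blast
    have DJ: "jet k (\<lambda>x. ?D f (at x) v) x = jet k (\<lambda>x. ?D g (at x) v) x" for v
      using Suc.prems(4) by (auto simp: jet_Suc_eq_iff)
    show ?case
      using S
    proof (rule jet_Suc_eqI)
      show "F (f x) = F (g x)" using Suc.prems(4)[THEN jet_eq_imp_eq] by simp
      show "((\<lambda>x. F (f x)) has_derivative
          (\<lambda>v. \<Sum>b\<in>B. coord b (?D f (at y) v) *\<^sub>R frechet_derivative F (at (f y)) b)) (at y)" if "y \<in> S" for y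
        by (intro has_derivative_compose_coordinates bl x Ck_on_has_derivative[OF Suc.prems(1)]
            Ck_on_has_derivative[OF Suc.prems(3)] that T)
      show "((\<lambda>x. F (g x)) has_derivative
          (\<lambda>v. \<Sum>b\<in>B. coord b (?D g (at y) v) *\<^sub>R frechet_derivative F (at (g y)) b)) (at y)" if "y \<in> S" for y
        by (intro has_derivative_compose_coordinates bl x Ck_on_has_derivative[OF Suc.prems(2)]
            Ck_on_has_derivative[OF Suc.prems(3)] that T)
      fix v
      have "jet k (\<lambda>y. coord b (?D f (at y) v)) x = jet k (\<lambda>y. coord b (?D g (at y) v)) x" for b
        by (rule jet_bounded_linear_cong[OF S bl d(1) d(2) DJ])
      moreover have "jet k (\<lambda>y. frechet_derivative F (at (f y)) b) x = jet k (\<lambda>y. frechet_derivative F (at (g y)) b) x" for b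
        by (intro Suc.IH c d J)
      ultimately show "jet k (\<lambda>y. \<Sum>b\<in>B. coord b (?D f (at y) v) *\<^sub>R frechet_derivative F (at (f y)) b) x
          = jet k (\<lambda>y. \<Sum>b\<in>B. coord b (?D g (at y) v) *\<^sub>R frechet_derivative F (at (g y)) b) x"
        by (intro jet_sum_cong[OF S] jet_scaleR_cong[OF S] Ck_on_scaleR[OF S(1)] c')
    qed
  qed
qed

lemma continuous_on_deriv_along:
  "Ck_on k S f \<Longrightarrow> length vs \<le> k \<Longrightarrow> continuous_on S (deriv_along f vs)"
proof (induction vs arbitrary: f k)
  case Nil
  then show ?case using Ck_on_imp_continuous_on by auto
next
  case (Cons v vs)
  then obtain j where k: "k = Suc j" "length vs \<le> j" by (cases k) auto
  show ?case
    unfolding deriv_along.simps using Cons.prems(1) k by (intro Cons.IH[OF _ k(2)]) simp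
qed

lemma continuous_on_jet:
  assumes "Ck_on k S f"
  shows "continuous_on S (jet k f)"
proof (rule continuous_on_coordinatewise_then_product)
  show "continuous_on S (\<lambda>x. jet k f x vs)" for vs
    using continuous_on_deriv_along[OF assms, of vs]
    by (cases "length vs \<le> k") (simp_all add: jet_def continuous_on_const)
qed

section \<open>A Baire argument\<close>

text \<open>Each agreement set \<open>F g\<close> is closed because \<open>Y\<close> is Hausdorff.
  Removing the union \<open>G\<close> of all their interiors leaves closed sets without interior,
  countably many, whose union is the complement of \<open>G\<close>. By Baire that complement
  contains no nonempty open set, so \<open>N\<close> meets the interior of some
  \<open>F g\<close>.\<close>

lemma dense_interiors_of_agreement:
  assumes X: "compact_space X" "Hausdorff_space X"
    and A: "countable A" "\<And>g. g \<in> A \<Longrightarrow> continuous_map X Y g"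
    and Y: "Hausdorff_space Y" and h: "continuous_map X Y h"
    and cover: "\<And>x. x \<in> topspace X \<Longrightarrow> \<exists>g\<in>A. h x = g x"
    and N: "openin X N" "N \<noteq> {}"
  obtains g T where "g \<in> A" "openin X T" "T \<noteq> {}" "T \<subseteq> N" "\<And>x. x \<in> T \<Longrightarrow> h x = g x"
proof -
  define F where "F = (\<lambda>g. {x \<in> topspace X. h x = g x})"
  define G where "G = (\<Union>g\<in>A. X interior_of F g)"
  have G: "openin X G" unfolding G_def by (intro openin_clauses(3)) auto
  have "X interior_of \<Union> ((\<lambda>g. F g - G) ` A) = {}"
  proof (rule Baire_category_alt)
    show "completely_metrizable_space X \<or> locally_compact_space X \<and> regular_space X"
      using X compact_imp_locally_compact_space compact_Hausdorff_imp_regular_space by blast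
    show "countable ((\<lambda>g. F g - G) ` A)" using A(1) by simp
    fix T assume "T \<in> (\<lambda>g. F g - G) ` A"
    then obtain g where g: "g \<in> A" "T = F g - G" by blast
    have "closedin X (F g)"
      unfolding F_def using closedin_continuous_maps_eq[OF Y h A(2)[OF g(1)]] .
    then have "closedin X T" using g(2) G closedin_diff by blast
    \<comment> \<open>An open subset of \<open>F g\<close> lies in the interior of
      \<open>F g\<close>, hence in \<open>G\<close>, which \<open>T\<close> avoids.\<close>
    moreover have "X interior_of T \<subseteq> G"
      using g interior_of_mono[of T "F g" X] by (auto simp: G_def)
    then have "X interior_of T = {}"
      using g(2) interior_of_subset[of X T] by blast
    ultimately show "closedin X T \<and> X interior_of T = {}" ..
  qed
  moreover have "\<Union> ((\<lambda>g. F g - G) ` A) = topspace X - G"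
    using cover by (auto simp: F_def)
  ultimately have "\<not> N \<subseteq> topspace X - G"
    using N interior_of_maximal by fastforce
  then have "N \<inter> G \<noteq> {}" using N(1) openin_subset by fastforce
  then obtain g where g: "g \<in> A" "N \<inter> X interior_of F g \<noteq> {}" unfolding G_def by blast
  show ?thesis
  proof
    show "openin X (N \<inter> X interior_of F g)" using N(1) by auto
    show "h x = g x" if "x \<in> N \<inter> X interior_of F g" for x
      using that interior_of_subset[of X "F g"] by (auto simp: F_def)
  qed (use g in auto)
qed

section \<open>Charts and local parametrizations\<close>

lemma homeomorphic_map_subtopology_preimage:
  assumes "openin X (f ` W)" "homeomorphic_map (top_of_set W) (subtopology X (f ` W)) f"
    and "open W" "openin X T"
  shows "open (W \<inter> f -` T)"
proof -
  have "continuous_map (top_of_set W) X f"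
    using assms(2) homeomorphic_imp_continuous_map continuous_map_in_subtopology by blast
  then have "openin (top_of_set W) {x \<in> topspace (top_of_set W). f x \<in> T}"
    using assms(4) openin_continuous_map_preimage by blast
  moreover have "{x \<in> topspace (top_of_set W). f x \<in> T} = W \<inter> f -` T" by auto
  ultimately show ?thesis using assms(3) openin_open_eq by auto
qed

lemma homeomorphic_map_subtopology_image:
  assumes "openin X (f ` W)" "homeomorphic_map (top_of_set W) (subtopology X (f ` W)) f"
    and "open N" "N \<subseteq> W"
  shows "openin X (f ` N)"
proof -
  have "openin (top_of_set W) N" using assms(3,4) open_subset by blast
  then have "openin (subtopology X (f ` W)) (f ` N)"
    using homeomorphic_imp_open_map[OF assms(2)] open_map_def by blast
  then show ?thesis using assms(1) openin_trans_full by blast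
qed

lemma openin_Int_vimage:
  "continuous_map X Y f \<Longrightarrow> openin X U \<Longrightarrow> openin Y T \<Longrightarrow> openin X (U \<inter> f -` T)"
  using openin_continuous_map_preimage_gen[of X Y f U T]
  by (simp add: vimage_def Int_def conj_commute)

text \<open>This is \<open>local_param\<close> with the domain made explicit and without the
  condition that it contain 0, so that one map can be recentred at any point of its domain.\<close>

definition Ck_embedding ::
  "nat \<Rightarrow> ('p, 'e::real_normed_vector) charted_space \<Rightarrow> 'e set \<Rightarrow> ('e \<Rightarrow> 'p) \<Rightarrow> bool" where
  "Ck_embedding k M W u \<longleftrightarrow>
     open W \<and> openin (mtop M) (u ` W) \<and>
     homeomorphic_map (top_of_set W) (subtopology (mtop M) (u ` W)) u \<and>
     (\<forall>(U, c) \<in> charts M.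
        Ck_on k (W \<inter> u -` U) (c \<circ> u) \<and>
        Ck_on k (c ` (U \<inter> u ` W)) (inv_into W u \<circ> inv_into U c))"

lemma Ck_embeddingI:
  assumes "open W" "openin (mtop M) (u ` W)"
    and "homeomorphic_map (top_of_set W) (subtopology (mtop M) (u ` W)) u"
    and "\<And>U c. (U, c) \<in> charts M \<Longrightarrow> Ck_on k (W \<inter> u -` U) (c \<circ> u)"
    and "\<And>U c. (U, c) \<in> charts M \<Longrightarrow>
      Ck_on k (c ` (U \<inter> u ` W)) (inv_into W u \<circ> inv_into U c)"
  shows "Ck_embedding k M W u"
  using assms unfolding Ck_embedding_def by blast

lemma local_param_iff: "local_param k M u \<longleftrightarrow> (\<exists>W. 0 \<in> W \<and> Ck_embedding k M W u)"
  unfolding local_param_def Ck_embedding_def by auto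

lemma Ck_embeddingD:
  assumes "Ck_embedding k M W u"
  shows "open W" "openin (mtop M) (u ` W)" "inj_on u W" "u ` W \<subseteq> points M"
    "homeomorphic_map (top_of_set W) (subtopology (mtop M) (u ` W)) u"
    "(U, c) \<in> charts M \<Longrightarrow> Ck_on k (W \<inter> u -` U) (c \<circ> u)"
    "(U, c) \<in> charts M \<Longrightarrow> Ck_on k (c ` (U \<inter> u ` W)) (inv_into W u \<circ> inv_into U c)"
  using assms homeomorphic_imp_injective_map[of "top_of_set W" _ u]
  by (auto simp: Ck_embedding_def dest: openin_subset)

lemma Ck_embedding_open_vimage:
  "Ck_embedding k M W u \<Longrightarrow> openin (mtop M) T \<Longrightarrow> open (W \<inter> u -` T)"
  by (meson Ck_embeddingD homeomorphic_map_subtopology_preimage)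

lemma Ck_embedding_openin_image:
  "Ck_embedding k M W u \<Longrightarrow> open N \<Longrightarrow> N \<subseteq> W \<Longrightarrow> openin (mtop M) (u ` N)"
  by (meson Ck_embeddingD homeomorphic_map_subtopology_image)

section \<open>Maps and diffeomorphisms of class C^r\<close>

lemma Cr_mapI:
  assumes "continuous_map (mtop M) (mtop N) f"
    and "\<And>U c U' c'. (U, c) \<in> charts M \<Longrightarrow> (U', c') \<in> charts N \<Longrightarrow>
      Ck_on r (c ` (U \<inter> f -` U')) (c' \<circ> f \<circ> inv_into U c)"
  shows "Cr_map r M N f"
  using assms unfolding Cr_map_def by blast

lemma Cr_map_mono: "Cr_map r M N f \<Longrightarrow> k \<le> r \<Longrightarrow> Cr_map k M N f"
  unfolding Cr_map_def using Ck_on_mono by blast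

lemma Diff_mono: "h \<in> Diff r M \<Longrightarrow> k \<le> r \<Longrightarrow> h \<in> Diff k M"
  unfolding Diff_def using Cr_map_mono by blast

lemma DiffD:
  assumes "h \<in> Diff r M"
  shows "h \<in> Bij (points M)" "bij_betw h (points M) (points M)" "h \<in> extensional (points M)"
    "Cr_map r M M h" "Cr_map r M M (inv_into (points M) h)"
    "continuous_map (mtop M) (mtop M) h" "continuous_map (mtop M) (mtop M) (inv_into (points M) h)"
  using assms by (auto simp: Diff_def Bij_def Cr_map_def)

lemma Diff_homeomorphic_map:
  assumes "h \<in> Diff r M"
  shows "homeomorphic_map (mtop M) (mtop M) h"
proof -
  have "homeomorphic_maps (mtop M) (mtop M) h (inv_into (points M) h)"
    using DiffD[OF assms] unfolding homeomorphic_maps_def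
    by (auto simp: bij_betw_inv_into_left bij_betw_inv_into_right)
  then show ?thesis by (rule homeomorphic_maps_imp_map)
qed

context
  fixes M :: "('p, 'e::real_normed_vector) charted_space"
  assumes M: "smooth_manifold M"
begin

lemma finite_dim: "\<exists>B. finite B \<and> span B = (UNIV :: 'e set)"
  using M unfolding smooth_manifold_def by blast

lemma chartD:
  assumes "(U, c) \<in> charts M"
  shows "openin (mtop M) U" "open (c ` U)" "inj_on c U" "U \<subseteq> points M"
    "homeomorphic_map (subtopology (mtop M) U) (top_of_set (c ` U)) c"
proof -
  have *: "openin (mtop M) U \<and> open (c ` U) \<and>
        homeomorphic_map (subtopology (mtop M) U) (top_of_set (c ` U)) c"
    using M assms unfolding smooth_manifold_def by blast
  then show "openin (mtop M) U" "open (c ` U)"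
    "homeomorphic_map (subtopology (mtop M) U) (top_of_set (c ` U)) c" by auto
  show 1: "U \<subseteq> points M" using * openin_subset by blast
  show "inj_on c U"
    using * 1 homeomorphic_imp_injective_map[of _ _ c] by (metis topspace_subtopology_subset)
qed

lemma chart_at:
  assumes "x \<in> points M"
  obtains U c where "(U, c) \<in> charts M" "x \<in> U"
proof -
  have "x \<in> \<Union> (fst ` charts M)" using assms M unfolding smooth_manifold_def by blast
  then show ?thesis using that by force
qed

lemma chart_open_image:
  assumes "(U, c) \<in> charts M" "openin (mtop M) T" "T \<subseteq> U"
  shows "open (c ` T)"
proof -
  have "openin (subtopology (mtop M) U) T"
    using assms(2,3) by (metis openin_subtopology inf.absorb1)
  then have "openin (top_of_set (c ` U)) (c ` T)"
    using homeomorphic_imp_open_map[OF chartD(5)[OF assms(1)]] open_map_def by blast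
  then show ?thesis using chartD(2)[OF assms(1)] openin_open_eq by blast
qed

lemma chart_inv_homeomorphic:
  assumes "(U, c) \<in> charts M"
  shows "homeomorphic_map (top_of_set (c ` U)) (subtopology (mtop M) U) (inv_into U c)"
proof -
  obtain g where g: "homeomorphic_maps (subtopology (mtop M) U) (top_of_set (c ` U)) c g"
    using chartD(5)[OF assms] homeomorphic_map_maps by blast
  then have "g (c x) = x" if "x \<in> U" for x
    using that chartD(4)[OF assms] unfolding homeomorphic_maps_def by auto
  then have "g y = inv_into U c y" if "y \<in> c ` U" for y
    using that chartD(3)[OF assms] by (metis f_inv_into_f inv_into_into)
  moreover have "homeomorphic_map (top_of_set (c ` U)) (subtopology (mtop M) U) g"
    using g homeomorphic_maps_map by blast
  ultimately show ?thesis by (elim homeomorphic_map_eq) simp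
qed

text \<open>Both regularity conditions reduce to smoothness of transition maps, since inverting
  \<open>inv_into U c\<close> gives back \<open>c\<close> on \<open>U\<close>.\<close>

lemma Ck_embedding_chart:
  assumes c: "(U, c) \<in> charts M"
  shows "Ck_embedding k M (c ` U) (inv_into U c)"
proof -
  have im: "inv_into U c ` c ` U = U" using chartD(3)[OF c] by simp
  have tr: "Ck_on k (c ` (U \<inter> U')) (c' \<circ> inv_into U c)"
    if "(U, c) \<in> charts M" "(U', c') \<in> charts M" for U c U' c'
    using M that unfolding smooth_manifold_def smooth_on_def by blast
  have "Ck_on k (c ` U \<inter> inv_into U c -` U') (c' \<circ> inv_into U c)" if "(U', c') \<in> charts M" for U' c'
  proof -
    have "c ` U \<inter> inv_into U c -` U' = c ` (U \<inter> U')" using chartD(3)[OF c] by auto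
    then show ?thesis using tr[OF c that] by simp
  qed
  moreover have "Ck_on k (c' ` (U' \<inter> U)) (inv_into (c ` U) (inv_into U c) \<circ> inv_into U' c')"
    if c': "(U', c') \<in> charts M" for U' c'
  proof (rule Ck_on_cong)
    show "Ck_on k (c' ` (U' \<inter> U)) (c \<circ> inv_into U' c')" using tr[OF c' c] .
    show "open (c' ` (U' \<inter> U))"
      using chart_open_image[OF c'] chartD(1)[OF c] chartD(1)[OF c'] by blast
    have "inv_into (c ` U) (inv_into U c) x = c x" if "x \<in> U" for x
      using that chartD(3)[OF c] by (intro inv_into_f_eq) (auto simp: inj_on_inv_into)
    then show "(c \<circ> inv_into U' c') y = (inv_into (c ` U) (inv_into U c) \<circ> inv_into U' c') y"
      if "y \<in> c' ` (U' \<inter> U)" for y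
      using that chartD(3)[OF c'] by auto
  qed
  ultimately show ?thesis
    using chartD[OF c] chart_inv_homeomorphic[OF c] unfolding Ck_embedding_def im by auto
qed

text \<open>Translation by \<open>t\<close> makes an arbitrary point of the domain the new origin;
  this is how one embedding yields frames over all points of its image.\<close>

lemma Ck_embedding_shift:
  assumes u: "Ck_embedding k M W u"
  shows "Ck_embedding k M ((\<lambda>x. x - t) ` W) (\<lambda>x. u (x + t))"
proof -
  have im: "(\<lambda>x. u (x + t)) ` (\<lambda>x. x - t) ` W = u ` W" by (simp add: image_image)
  have "homeomorphic_maps (top_of_set ((\<lambda>x. x - t) ` W)) (top_of_set W) (\<lambda>x. x + t) (\<lambda>x. x - t)"
    unfolding homeomorphic_maps_def by (auto intro!: continuous_intros)
  then have "homeomorphic_map (top_of_set ((\<lambda>x. x - t) ` W)) (top_of_set W) (\<lambda>x. x + t)"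
    by (rule homeomorphic_maps_imp_map)
  from homeomorphic_map_compose[OF this Ck_embeddingD(5)[OF u]]
  have hom: "homeomorphic_map (top_of_set ((\<lambda>x. x - t) ` W)) (subtopology (mtop M) (u ` W))
      (\<lambda>x. u (x + t))"
    by (simp add: comp_def)
  have op: "open ((\<lambda>x. x - t) ` W)"
    using open_translation_subtract[OF Ck_embeddingD(1)[OF u]] .
  have 1: "Ck_on k ((\<lambda>x. x - t) ` W \<inter> (\<lambda>x. u (x + t)) -` U) (c \<circ> (\<lambda>x. u (x + t)))"
    if c: "(U, c) \<in> charts M" for U c
  proof -
    have "(\<lambda>x. x - t) ` W \<inter> (\<lambda>x. u (x + t)) -` U = (\<lambda>x. x - t) ` (W \<inter> u -` U)" by auto
    then show ?thesis
      using Ck_on_shift[OF Ck_embeddingD(6)[OF u c], of t] by (simp add: comp_def)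
  qed
  have 2: "Ck_on k (c ` (U \<inter> u ` W))
      (inv_into ((\<lambda>x. x - t) ` W) (\<lambda>x. u (x + t)) \<circ> inv_into U c)"
    if c: "(U, c) \<in> charts M" for U c
  proof (rule Ck_on_cong)
    show o: "open (c ` (U \<inter> u ` W))"
      using chart_open_image[OF c] chartD(1)[OF c] Ck_embeddingD(2)[OF u] by blast
    \<comment> \<open>The inverse of the recentred map is the old inverse minus
      \<open>t\<close>.\<close>
    show "Ck_on k (c ` (U \<inter> u ` W)) (\<lambda>x. (inv_into W u \<circ> inv_into U c) x + (- t))"
      using Ck_on_add[OF o Ck_embeddingD(7)[OF u c] Ck_on_const[OF o]] .
    have "inv_into ((\<lambda>x. x - t) ` W) (\<lambda>x. u (x + t)) (u w) = inv_into W u (u w) + (- t)"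
      if "w \<in> W" for w
      using that Ck_embeddingD(3)[OF u]
      by (intro inv_into_f_eq) (auto simp: inj_on_def)
    then show "(inv_into W u \<circ> inv_into U c) y + (- t)
        = (inv_into ((\<lambda>x. x - t) ` W) (\<lambda>x. u (x + t)) \<circ> inv_into U c) y"
      if "y \<in> c ` (U \<inter> u ` W)" for y
      using that chartD(3)[OF c] by auto
  qed
  show ?thesis
    using op Ck_embeddingD(2)[OF u] hom 1 2 unfolding im[symmetric] by (rule Ck_embeddingI)
qed

text \<open>Near a point, a chart \<open>c'\<close> around its image under \<open>u\<close> is
  inserted between \<open>h\<close> and \<open>u\<close>. The hypotheses on \<open>u\<close> only
  say that it is a C^k map from \<open>S\<close> into M, so \<open>u\<close> may be an embedding or
  a diffeomorphism read through an inverse chart.\<close>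

lemma Cr_map_compose_param:
  assumes h: "Cr_map k M M h" and S: "open S"
    and u: "\<And>x. x \<in> S \<Longrightarrow> u x \<in> points M" "\<And>T. openin (mtop M) T \<Longrightarrow> open (S \<inter> u -` T)"
      "\<And>U c. (U, c) \<in> charts M \<Longrightarrow> Ck_on k (S \<inter> u -` U) (c \<circ> u)"
    and c: "(U, c) \<in> charts M" "\<And>x. x \<in> S \<Longrightarrow> h (u x) \<in> U"
  shows "Ck_on k S (c \<circ> h \<circ> u)"
proof (rule Ck_on_locally)
  fix x assume x: "x \<in> S"
  obtain U' c' where c': "(U', c') \<in> charts M" "u x \<in> U'"
    using chart_at[OF u(1)[OF x]] .
  let ?T = "S \<inter> u -` U'"
  have o: "open ?T" using u(2) chartD(1)[OF c'(1)] by blast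
  have "Ck_on k (c' ` (U' \<inter> h -` U)) (c \<circ> h \<circ> inv_into U' c')"
    using h c(1) c'(1) unfolding Cr_map_def by blast
  then have "Ck_on k ?T (\<lambda>x. (c \<circ> h \<circ> inv_into U' c') ((c' \<circ> u) x))"
    by (rule Ck_on_compose[OF finite_dim o u(3)[OF c'(1)]]) (use c(2) in auto)
  then have "Ck_on k ?T (c \<circ> h \<circ> u)"
    using o chartD(3)[OF c'(1)] by (elim Ck_on_cong[rotated 2]) auto
  then show "\<exists>T. open T \<and> x \<in> T \<and> Ck_on k T (c \<circ> h \<circ> u)"
    using o x c'(2) by blast
qed

lemma Cr_map_compose:
  assumes g: "Cr_map k M M g" and f: "Cr_map k M M f"
  shows "Cr_map k M M (g \<circ> f)"
proof (rule Cr_mapI)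
  have cf: "continuous_map (mtop M) (mtop M) f" and cg: "continuous_map (mtop M) (mtop M) g"
    using f g by (auto simp: Cr_map_def)
  then show cgf: "continuous_map (mtop M) (mtop M) (g \<circ> f)"
    by (rule continuous_map_compose)
  show "Ck_on k (c ` (U \<inter> (g \<circ> f) -` U')) (c' \<circ> (g \<circ> f) \<circ> inv_into U c)"
    if c: "(U, c) \<in> charts M" and c': "(U', c') \<in> charts M" for U c U' c'
  proof -
    note inj = chartD(3)[OF c]
    let ?S = "c ` (U \<inter> (g \<circ> f) -` U')"
    have op: "open (c ` (U \<inter> h -` T))" if "continuous_map (mtop M) (mtop M) h" "openin (mtop M) T"
      for h :: "'p \<Rightarrow> 'p" and T
      using chart_open_image[OF c] openin_Int_vimage[OF that(1) chartD(1)[OF c] that(2)] by blast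
    have "Ck_on k ?S (c' \<circ> g \<circ> (f \<circ> inv_into U c))"
    proof (rule Cr_map_compose_param[OF g])
      show "open ?S" using op[OF cgf chartD(1)[OF c']] .
      show "(f \<circ> inv_into U c) x \<in> points M" if "x \<in> ?S" for x
        using that inj chartD(4)[OF c] cf by (auto simp: continuous_map_def Pi_iff)
      have eq: "?S \<inter> (f \<circ> inv_into U c) -` T = ?S \<inter> c ` (U \<inter> f -` T)" for T
        using inj by (auto simp: inj_on_eq_iff)
      show "open (?S \<inter> (f \<circ> inv_into U c) -` T)" if "openin (mtop M) T" for T
        using op[OF cf that] op[OF cgf chartD(1)[OF c']] eq by auto
      show "Ck_on k (?S \<inter> (f \<circ> inv_into U c) -` U'') (c'' \<circ> (f \<circ> inv_into U c))"
        if "(U'', c'') \<in> charts M" for U'' c''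
      proof (rule Ck_on_subset)
        show "Ck_on k (c ` (U \<inter> f -` U'')) (c'' \<circ> (f \<circ> inv_into U c))"
          using f c that unfolding Cr_map_def comp_assoc by blast
        show "?S \<inter> (f \<circ> inv_into U c) -` U'' \<subseteq> c ` (U \<inter> f -` U'')"
          using eq by blast
      qed
      show "g ((f \<circ> inv_into U c) x) \<in> U'" if "x \<in> ?S" for x
        using that inj by auto
    qed (rule c')
    then show "Ck_on k ?S (c' \<circ> (g \<circ> f) \<circ> inv_into U c)" by (simp add: comp_assoc)
  qed
qed

text \<open>Bridges \<open>\<circ>\<close> and the extensional \<open>compose\<close>, and likewise
  the inverse of a composite, which are controlled only on \<open>points M\<close>.\<close>

lemma Cr_map_cong:
  assumes "Cr_map k M M f" "\<And>x. x \<in> points M \<Longrightarrow> f x = g x"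
  shows "Cr_map k M M g"
proof (rule Cr_mapI)
  have cf: "continuous_map (mtop M) (mtop M) f" using assms by (auto simp: Cr_map_def)
  then show cg: "continuous_map (mtop M) (mtop M) g"
    using assms(2) continuous_map_eq by blast
  show "Ck_on k (c ` (U \<inter> g -` U')) (c' \<circ> g \<circ> inv_into U c)"
    if c: "(U, c) \<in> charts M" and c': "(U', c') \<in> charts M" for U c U' c'
  proof -
    have eq: "f x = g x" if "x \<in> U" for x using that chartD(4)[OF c] assms(2) by blast
    show ?thesis
    proof (rule Ck_on_cong)
      show "open (c ` (U \<inter> g -` U'))"
        using chart_open_image[OF c] openin_Int_vimage[OF cg chartD(1)[OF c] chartD(1)[OF c']]
        by blast
      have "U \<inter> g -` U' = U \<inter> f -` U'" using eq by auto
      then show "Ck_on k (c ` (U \<inter> g -` U')) (c' \<circ> f \<circ> inv_into U c)"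
        using assms(1) c c' unfolding Cr_map_def by fastforce
      show "(c' \<circ> f \<circ> inv_into U c) y = (c' \<circ> g \<circ> inv_into U c) y"
        if "y \<in> c ` (U \<inter> g -` U')" for y
        using that eq chartD(3)[OF c] by auto
    qed
  qed
qed

lemma Diff_compose:
  assumes g: "g \<in> Diff r M" and f: "f \<in> Diff r M"
  shows "compose (points M) g f \<in> Diff r M"
proof -
  note F = DiffD[OF f] and G = DiffD[OF g]
  let ?P = "points M" and ?h = "compose (points M) g f"
  have B: "?h \<in> Bij ?P" using compose_Bij[OF G(1) F(1)] .
  then have bij: "bij_betw ?h ?P ?P" by (simp add: Bij_def)
  have h: "?h x = g (f x)" if "x \<in> ?P" for x using that by (simp add: compose_def)
  have "Cr_map r M M ?h"
    using Cr_map_compose[OF G(4) F(4)] by (rule Cr_map_cong) (simp add: h)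
  moreover have "Cr_map r M M (inv_into ?P ?h)"
    using Cr_map_compose[OF F(5) G(5)]
  proof (rule Cr_map_cong)
    fix x assume x: "x \<in> ?P"
    let ?y = "inv_into ?P f (inv_into ?P g x)"
    have 1: "inv_into ?P g x \<in> ?P" using Bij_inv_into_mem[OF G(1) x] .
    have 2: "?y \<in> ?P" using Bij_inv_into_mem[OF F(1) 1] .
    have "?h ?y = x"
      using h[OF 2] 1 x F(2) G(2) by (simp add: bij_betw_inv_into_right)
    then show "(inv_into ?P f \<circ> inv_into ?P g) x = inv_into ?P ?h x"
      using 2 bij by (metis bij_betw_inv_into_left comp_apply)
  qed
  ultimately show ?thesis using B by (simp add: Diff_def)
qed

lemma Ck_embedding_compose:
  assumes h: "h \<in> Diff k M" and u: "Ck_embedding k M W u"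
  shows "Ck_embedding k M W (h \<circ> u)"
proof -
  let ?P = "points M"
  let ?ih = "inv_into ?P h"
  note H = DiffD[OF h] and U = Ck_embeddingD[OF u]
  have uP: "u x \<in> ?P" if "x \<in> W" for x using U(4) that by blast
  have hP: "h x \<in> ?P" if "x \<in> ?P" for x using H(2) that bij_betwE by blast
  have injh: "inj_on h ?P" using H(2) bij_betw_def by blast
  have im: "(h \<circ> u) ` W = h ` u ` W" by auto
  have oim: "openin (mtop M) ((h \<circ> u) ` W)"
    unfolding im using Diff_homeomorphic_map[OF h] U(2) homeomorphic_map_openness_eq by blast
  have "homeomorphic_map (subtopology (mtop M) (u ` W)) (subtopology (mtop M) ((h \<circ> u) ` W)) h"
    using Diff_homeomorphic_map[OF h] U(4) openin_subset[OF oim]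
    by (intro homeomorphic_map_subtopologies) (auto simp: im inf.absorb2)
  with U(5) have hom: "homeomorphic_map (top_of_set W) (subtopology (mtop M) ((h \<circ> u) ` W)) (h \<circ> u)"
    by (rule homeomorphic_map_compose)
  have 1: "Ck_on k (W \<inter> (h \<circ> u) -` U) (c \<circ> (h \<circ> u))" if c: "(U, c) \<in> charts M" for U c
  proof -
    let ?S = "W \<inter> (h \<circ> u) -` U"
    \<comment> \<open>The intersection with \<open>?P\<close> matters: off \<open>points M\<close>
      the extensional \<open>h\<close> is \<open>undefined\<close>, a value that might lie in
      \<open>U\<close>, so the bare preimage of \<open>U\<close> need not be open in M.\<close>
    have S: "?S = W \<inter> u -` (?P \<inter> h -` U)" using uP by auto
    have opS: "open ?S"
      unfolding S using openin_Int_vimage[OF H(6) openin_topspace chartD(1)[OF c]]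
      by (rule Ck_embedding_open_vimage[OF u])
    have "Ck_on k ?S (c \<circ> h \<circ> u)"
    proof (rule Cr_map_compose_param[OF H(4) opS _ _ _ c])
      show "open (?S \<inter> u -` T)" if "openin (mtop M) T" for T
      proof -
        have "?S \<inter> u -` T = ?S \<inter> (W \<inter> u -` T)" by blast
        then show ?thesis using opS Ck_embedding_open_vimage[OF u that] by auto
      qed
      show "Ck_on k (?S \<inter> u -` U') (c' \<circ> u)" if "(U', c') \<in> charts M" for U' c'
        using U(6)[OF that] by (rule Ck_on_subset) blast
    qed (use uP in auto)
    then show ?thesis by (simp add: comp_assoc)
  qed
  have 2: "Ck_on k (c ` (U \<inter> (h \<circ> u) ` W)) (inv_into W (h \<circ> u) \<circ> inv_into U c)"
    if c: "(U, c) \<in> charts M" for U c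
  proof (rule Ck_on_locally)
    fix y assume "y \<in> c ` (U \<inter> (h \<circ> u) ` W)"
    then obtain w where w: "w \<in> W" "h (u w) \<in> U" "y = c (h (u w))" by auto
    obtain U' c' where c': "(U', c') \<in> charts M" "u w \<in> U'"
      using chart_at[OF uP[OF w(1)]] .
    note inj = chartD(3)[OF c]
    have ih: "?ih (h x) = x" if "x \<in> ?P" for x using injh that by simp
    have hih: "h (?ih x) = x" if "x \<in> ?P" for x using H(2) that by (simp add: bij_betw_inv_into_right)
    have UP: "x \<in> ?P" if "x \<in> U" for x using that chartD(4)[OF c] by blast
    \<comment> \<open>On \<open>?T\<close> the inverse of \<open>h\<close> lands both in the chart
      \<open>U'\<close> and in the image of \<open>u\<close>, so the inverse of
      \<open>h \<circ> u\<close> factors through \<open>c'\<close> as a composite of two C^k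
      maps.\<close>
    let ?T = "c ` (U \<inter> ?ih -` (U' \<inter> u ` W))"
    have opT: "open ?T"
      using chart_open_image[OF c] openin_Int_vimage[OF H(7) chartD(1)[OF c]
          openin_Int[OF chartD(1)[OF c'(1)] U(2)]] by blast
    have "Ck_on k (c ` (U \<inter> ?ih -` U')) (c' \<circ> ?ih \<circ> inv_into U c)"
      using H(5) c c'(1) unfolding Cr_map_def by blast
    then have "Ck_on k ?T (c' \<circ> ?ih \<circ> inv_into U c)"
      by (rule Ck_on_subset) blast
    from finite_dim opT this U(7)[OF c'(1)]
    have "Ck_on k ?T (\<lambda>x. (inv_into W u \<circ> inv_into U' c') ((c' \<circ> ?ih \<circ> inv_into U c) x))"
      by (rule Ck_on_compose) (use inj in auto)
    then have "Ck_on k ?T (inv_into W (h \<circ> u) \<circ> inv_into U c)"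
    proof (rule Ck_on_cong[rotated 2])
      fix y assume "y \<in> ?T"
      then obtain p w where p: "p \<in> U" "?ih p \<in> U'" "?ih p = u w" "w \<in> W" "y = c p" by auto
      have "inj_on (h \<circ> u) W"
        using U(3) injh U(4) by (simp add: comp_inj_on inj_on_subset)
      moreover have "(h \<circ> u) w = p" using hih[OF UP[OF p(1)]] p(3) by simp
      ultimately have "inv_into W (h \<circ> u) p = w" using p(4) by (metis inv_into_f_f)
      moreover have "inv_into W u (u w) = w" using U(3) p(4) by simp
      moreover have "inv_into U' c' (c' (u w)) = u w"
        using p(2,3) chartD(3)[OF c'(1)] by simp
      ultimately show "(inv_into W u \<circ> inv_into U' c') ((c' \<circ> ?ih \<circ> inv_into U c) y)
          = (inv_into W (h \<circ> u) \<circ> inv_into U c) y"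
        using p inj by simp
    qed (rule opT)
    moreover have "y \<in> ?T" using w c'(2) ih uP by auto
    ultimately show "\<exists>T. open T \<and> y \<in> T \<and> Ck_on k T (inv_into W (h \<circ> u) \<circ> inv_into U c)"
      using opT by blast
  qed
  show ?thesis using U(1) oim hom 1 2 by (rule Ck_embeddingI)
qed

lemma local_param_compose:
  assumes "h \<in> Diff r M" "k \<le> r" "local_param k M u"
  shows "local_param k M (h \<circ> u)"
proof -
  obtain W where "0 \<in> W" "Ck_embedding k M W u" using assms(3) local_param_iff by blast
  then show ?thesis
    using Ck_embedding_compose[OF Diff_mono[OF assms(1,2)]] local_param_iff by blast
qed

lemma local_param_shift:
  assumes "Ck_embedding k M W u" "t \<in> W"
  shows "local_param k M (\<lambda>x. u (x + t))"
proof -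
  have "0 \<in> (\<lambda>x. x - t) ` W" using assms(2) by (intro image_eqI[of _ _ t]) auto
  with Ck_embedding_shift[OF assms(1)] show ?thesis
    unfolding local_param_iff by (intro exI conjI)
qed

lemma local_param_at:
  assumes "x \<in> points M"
  obtains u where "local_param k M u" "u 0 = x"
proof -
  obtain U c where c: "(U, c) \<in> charts M" "x \<in> U" using chart_at[OF assms] .
  show ?thesis
  proof
    show "local_param k M (\<lambda>y. inv_into U c (y + c x))"
      using Ck_embedding_chart[OF c(1)] by (rule local_param_shift) (use c(2) in blast)
    show "inv_into U c (0 + c x) = x" using chartD(3)[OF c(1)] c(2) by simp
  qed
qed

section \<open>Frames\<close>

lemma local_param_at_0: "local_param k M u \<Longrightarrow> u 0 \<in> points M"
  unfolding local_param_iff using Ck_embeddingD(4) by blast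

lemma jet_rel_refl: "local_param k M u \<Longrightarrow> (u, u) \<in> jet_rel k M"
  by (simp add: jet_rel_def)

lemma equiv_jet_rel: "equiv {u. local_param k M u} (jet_rel k M)"
proof (rule equivI)
  show "refl_on {u. local_param k M u} (jet_rel k M)"
    by (rule refl_onI) (auto simp: jet_rel_def)
  show "sym (jet_rel k M)" by (rule symI) (auto simp: jet_rel_def)
  show "trans (jet_rel k M)" by (rule transI) (fastforce simp: jet_rel_def)
  show "jet_rel k M \<subseteq> {u. local_param k M u} \<times> {u. local_param k M u}"
    by (auto simp: jet_rel_def)
qed

lemma jet_rel_cong_open:
  assumes "local_param k M u" "local_param k M v" "open S" "0 \<in> S" "\<And>x. x \<in> S \<Longrightarrow> u x = v x"
  shows "(u, v) \<in> jet_rel k M"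
  using assms jet_cong_open[OF assms(3,4), of "c \<circ> u" "c \<circ> v" for c] by (auto simp: jet_rel_def)

lemma local_param_open_nbhd:
  assumes "local_param k M u" "openin (mtop M) T" "u 0 \<in> T"
  obtains S where "open S" "0 \<in> S" "u ` S \<subseteq> T"
    "\<And>U c. (U, c) \<in> charts M \<Longrightarrow> T \<subseteq> U \<Longrightarrow> Ck_on k S (c \<circ> u)"
proof -
  obtain W where W: "0 \<in> W" "Ck_embedding k M W u" using assms(1) local_param_iff by blast
  show ?thesis
  proof
    show "open (W \<inter> u -` T)" using Ck_embedding_open_vimage W(2) assms(2) .
    show "0 \<in> W \<inter> u -` T" using W(1) assms(3) by simp
    show "u ` (W \<inter> u -` T) \<subseteq> T" by blast
    show "Ck_on k (W \<inter> u -` T) (c \<circ> u)" if "(U, c) \<in> charts M" "T \<subseteq> U" for U c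
      using Ck_embeddingD(6)[OF W(2) that(1)] by (rule Ck_on_subset) (use that(2) in blast)
  qed
qed

text \<open>In charts, \<open>h\<close> becomes a fixed C^k map applied to the coordinate
  representations of \<open>u\<close> and \<open>v\<close>, so \<open>jet_compose_cong\<close>
  applies once both are confined to a common neighbourhood of 0.\<close>

lemma jet_rel_compose:
  assumes h: "h \<in> Diff r M" "k \<le> r" and uv: "(u, v) \<in> jet_rel k M"
  shows "(h \<circ> u, h \<circ> v) \<in> jet_rel k M"
proof -
  have lp: "local_param k M u" "local_param k M v" and uv0: "u 0 = v 0"
    and J: "\<And>U c. (U, c) \<in> charts M \<Longrightarrow> u 0 \<in> U \<Longrightarrow> jet k (c \<circ> u) 0 = jet k (c \<circ> v) 0"
    using uv by (auto simp: jet_rel_def)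
  note H = DiffD[OF Diff_mono[OF h]]
  have "jet k (c' \<circ> (h \<circ> u)) 0 = jet k (c' \<circ> (h \<circ> v)) 0"
    if c': "(U', c') \<in> charts M" "h (u 0) \<in> U'" for U' c'
  proof -
    obtain U c where c: "(U, c) \<in> charts M" "u 0 \<in> U"
      using chart_at[OF local_param_at_0[OF lp(1)]] .
    let ?T = "U \<inter> h -` U'"
    have T: "openin (mtop M) ?T" using openin_Int_vimage H(6) chartD(1)[OF c(1)] chartD(1)[OF c'(1)] .
    obtain S1 where S1: "open S1" "0 \<in> S1" "u ` S1 \<subseteq> ?T" "Ck_on k S1 (c \<circ> u)"
      using local_param_open_nbhd[OF lp(1) T] c(1,2) c'(2) by (metis IntI inf_le1 vimage_eq)
    obtain S2 where S2: "open S2" "0 \<in> S2" "v ` S2 \<subseteq> ?T" "Ck_on k S2 (c \<circ> v)"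
      using local_param_open_nbhd[OF lp(2) T] c(1,2) c'(2) uv0 by (metis IntI inf_le1 vimage_eq)
    let ?S = "S1 \<inter> S2" and ?F = "c' \<circ> h \<circ> inv_into U c"
    have S: "open ?S" "0 \<in> ?S" using S1 S2 by auto
    have C: "Ck_on k ?S (c \<circ> u)" "Ck_on k ?S (c \<circ> v)"
      using S1(4) S2(4) by (auto elim: Ck_on_subset)
    have F: "Ck_on k (c ` ?T) ?F"
      using H(4) c(1) c'(1) unfolding Cr_map_def by blast
    have "jet k (\<lambda>x. ?F ((c \<circ> u) x)) 0 = jet k (\<lambda>x. ?F ((c \<circ> v) x)) 0"
      by (rule jet_compose_cong[OF finite_dim S C F _ _ J[OF c]])
        (use S1(3) S2(3) in \<open>auto simp: image_subset_iff\<close>)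
    moreover have "jet k (\<lambda>x. ?F ((c \<circ> u) x)) 0 = jet k (c' \<circ> (h \<circ> u)) 0"
      using S1(3) chartD(3)[OF c(1)] by (intro jet_cong_open[OF S1(1,2)]) auto
    moreover have "jet k (\<lambda>x. ?F ((c \<circ> v) x)) 0 = jet k (c' \<circ> (h \<circ> v)) 0"
      using S2(3) chartD(3)[OF c(1)] by (intro jet_cong_open[OF S2(1,2)]) auto
    ultimately show ?thesis by simp
  qed
  then show ?thesis
    using lp uv0 local_param_compose[OF h] by (auto simp: jet_rel_def)
qed

text \<open>\<open>frame_map\<close> collects the images of all representatives; compatibility with
  \<open>jet_rel\<close> and transitivity collapse them to a single class.\<close>

lemma frame_map_class:
  assumes h: "h \<in> Diff r M" "k \<le> r" and u: "local_param k M u"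
  shows "frame_map k M h (jet_rel k M `` {u}) = jet_rel k M `` {h \<circ> u}"
proof -
  have tr: "trans (jet_rel k M)" using equiv_jet_rel equivE by blast
  show ?thesis
    unfolding frame_map_def
    using jet_rel_compose[OF h] jet_rel_refl[OF u] transD[OF tr] by blast
qed

lemma frame_in_bundle: "local_param k M u \<Longrightarrow> jet_rel k M `` {u} \<in> frame_bundle k M"
  unfolding frame_bundle_def by (simp add: quotientI)

lemma frame_bundle_cases:
  assumes "p \<in> frame_bundle k M"
  obtains u where "local_param k M u" "p = jet_rel k M `` {u}"
  using assms unfolding frame_bundle_def by (auto elim: quotientE)

text \<open>The jets of \<open>u(\<sqdot> + t)\<close> at 0 in a chart are those of the fixed map \<open>u\<close> at \<open>t\<close>. Such
  curves of frames, unlike \<^const>\<open>frame_map\<close> itself, are thus seen to be continuous without a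
  higher-order chain rule.\<close>

lemma continuous_map_moving_frame:
  assumes u: "Ck_embedding k M W u"
  shows "continuous_map (top_of_set W) (frame_topology k M)
    (\<lambda>t. jet_rel k M `` {\<lambda>x. u (x + t)})"
proof -
  let ?P = "\<lambda>t. jet_rel k M `` {\<lambda>x. u (x + t)}"
  have lp: "local_param k M (\<lambda>x. u (x + t))" if "t \<in> W" for t
    using local_param_shift[OF u that] .
  have J: "jet k (c \<circ> (\<lambda>x. u (x + t))) 0 = jet k (c \<circ> u) t" for c :: "'p \<Rightarrow> 'e" and t
    using jet_shift[of k "c \<circ> u" t 0] by (simp add: comp_def)
  \<comment> \<open>A generating open set constrains all representatives of a frame; testing the
    recentred \<open>u\<close> alone suffices, as base point and jet in \<open>c\<close> are class
    invariants.\<close>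
  have mem: "(\<forall>v \<in> ?P t. v 0 \<in> U \<and> jet k (c \<circ> v) 0 \<in> S) \<longleftrightarrow> u t \<in> U \<and> jet k (c \<circ> u) t \<in> S"
    if c: "(U, c) \<in> charts M" and t: "t \<in> W" for U c S t
  proof
    assume *: "\<forall>v \<in> ?P t. v 0 \<in> U \<and> jet k (c \<circ> v) 0 \<in> S"
    have "(\<lambda>x. u (x + t)) \<in> ?P t" using jet_rel_refl[OF lp[OF t]] by blast
    from bspec[OF * this] show "u t \<in> U \<and> jet k (c \<circ> u) t \<in> S" unfolding J by simp
  next
    assume *: "u t \<in> U \<and> jet k (c \<circ> u) t \<in> S"
    show "\<forall>v \<in> ?P t. v 0 \<in> U \<and> jet k (c \<circ> v) 0 \<in> S"
    proof
      fix v assume "v \<in> ?P t"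
      then have v: "(\<lambda>x. u (x + t), v) \<in> jet_rel k M" by blast
      then have "v 0 = u t" by (auto simp: jet_rel_def)
      moreover have "jet k (c \<circ> v) 0 = jet k (c \<circ> u) t"
        using v c * J[of c t] by (fastforce simp: jet_rel_def)
      ultimately show "v 0 \<in> U \<and> jet k (c \<circ> v) 0 \<in> S" using * by simp
    qed
  qed
  show ?thesis
    unfolding frame_topology_def
  proof (rule continuous_on_generated_topo)
    fix G assume "G \<in> {{p \<in> frame_bundle k M. \<forall>v\<in>p. v 0 \<in> U \<and> jet k (c \<circ> v) 0 \<in> S} | U c S.
        (U, c) \<in> charts M \<and> open S}"
    then obtain U c S where G: "G = {p \<in> frame_bundle k M. \<forall>v\<in>p. v 0 \<in> U \<and> jet k (c \<circ> v) 0 \<in> S}"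
      and c: "(U, c) \<in> charts M" and S: "open S" by blast
    have "?P -` G \<inter> topspace (top_of_set W) = (W \<inter> u -` U) \<inter> jet k (c \<circ> u) -` S"
      using mem[OF c] frame_in_bundle[OF lp] by (auto simp: G)
    moreover have "open ((W \<inter> u -` U) \<inter> jet k (c \<circ> u) -` S)"
      using continuous_open_preimage[OF continuous_on_jet[OF Ck_embeddingD(6)[OF u c]]
          Ck_embedding_open_vimage[OF u chartD(1)[OF c]] S] .
    ultimately show "openin (top_of_set W) (?P -` G \<inter> topspace (top_of_set W))"
      by (metis inf_le2 open_subset topspace_euclidean_subtopology)
  next
    \<comment> \<open>The space of a generated topology is the union of its generators, so each
      frame must lie in one of them; \<open>S = UNIV\<close> in any chart around the base point will
      do.\<close>
    show "?P ` topspace (top_of_set W)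
      \<subseteq> \<Union> {{p \<in> frame_bundle k M. \<forall>v\<in>p. v 0 \<in> U \<and> jet k (c \<circ> v) 0 \<in> S} | U c S.
        (U, c) \<in> charts M \<and> open S}"
    proof clarify
      fix t assume "t \<in> topspace (top_of_set W)"
      then have t: "t \<in> W" by simp
      then obtain U c where c: "(U, c) \<in> charts M" "u t \<in> U"
        using chart_at Ck_embeddingD(4)[OF u] by (metis image_subset_iff)
      then have "?P t \<in> {p \<in> frame_bundle k M. \<forall>v\<in>p. v 0 \<in> U \<and> jet k (c \<circ> v) 0 \<in> UNIV}"
        using mem[OF c(1) t, of UNIV] frame_in_bundle[OF lp[OF t]] by simp
      then show "?P t \<in> \<Union> {{p \<in> frame_bundle k M. \<forall>v\<in>p. v 0 \<in> U \<and> jet k (c \<circ> v) 0 \<in> S} | U c S.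
        (U, c) \<in> charts M \<and> open S}"
        using c(1) open_UNIV by blast
    qed
  qed
qed

section \<open>Locally piecewise automorphisms\<close>

lemma Hausdorff_points: "Hausdorff_space (mtop M)"
  using M unfolding smooth_manifold_def by blast

text \<open>Along a moving frame \<open>[u(\<sqdot> + t)]\<close> the maps \<open>h\<close> and some \<open>g \<in> A\<close> have equal
  jets for a dense set of \<open>t\<close>, so invariance of \<open>\<omega>\<close> under \<open>A\<close> passes to \<open>h\<close> by
  continuity.\<close>

lemma piecewise_Aut:
  assumes comp: "compact_space (mtop M)"
    and V: "Hausdorff_space V" and \<omega>: "continuous_map (frame_topology k M) V \<omega>"
    and A: "countable A" "A \<subseteq> Aut r k M \<omega>" and kr: "k \<le> r"
    and h: "h \<in> Diff r M" and cover: "\<And>x. x \<in> points M \<Longrightarrow> \<exists>g\<in>A. h x = g x"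
  shows "h \<in> Aut r k M \<omega>"
  unfolding Aut_def
proof (intro CollectI conjI ballI h)
  fix p assume "p \<in> frame_bundle k M"
  then obtain u where lp: "local_param k M u" and p: "p = jet_rel k M `` {u}"
    by (rule frame_bundle_cases)
  then obtain W where W: "0 \<in> W" "Ck_embedding k M W u" using local_param_iff by blast
  let ?P = "\<lambda>t. jet_rel k M `` {\<lambda>x. u (x + t)}"
  let ?Q = "\<lambda>t. jet_rel k M `` {\<lambda>x. (h \<circ> u) (x + t)}"
  have hu: "Ck_embedding k M W (h \<circ> u)" using Ck_embedding_compose[OF Diff_mono[OF h kr] W(2)] .
  have cP: "continuous_map (top_of_set W) V (\<lambda>t. \<omega> (?P t))"
    using continuous_map_compose[OF continuous_map_moving_frame[OF W(2)] \<omega>] by (simp add: comp_def)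
  have cQ: "continuous_map (top_of_set W) V (\<lambda>t. \<omega> (?Q t))"
    using continuous_map_compose[OF continuous_map_moving_frame[OF hu] \<omega>] by (simp add: comp_def)
  have "\<omega> (?Q 0) = \<omega> (?P 0)"
  proof (rule ccontr)
    assume ne: "\<omega> (?Q 0) \<noteq> \<omega> (?P 0)"
    \<comment> \<open>The parameters where invariance fails form an open set because V is Hausdorff.
      Its image under \<open>u\<close> is open in M, so Baire can be applied on the compact space M
      and the result pulled back to a parameter \<open>t\<close>.\<close>
    define N where "N = W - {t \<in> W. \<omega> (?Q t) = \<omega> (?P t)}"
    have "closedin (top_of_set W) {t \<in> W. \<omega> (?Q t) = \<omega> (?P t)}"
      using closedin_continuous_maps_eq[OF V cQ cP] by simp
    then have "openin (top_of_set W) N" unfolding N_def by (simp add: openin_diff)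
    then have N: "open N" "N \<subseteq> W" "0 \<in> N"
      using openin_open_eq[OF Ck_embeddingD(1)[OF W(2)]] ne W(1) by (auto simp: N_def)
    have "openin (mtop M) (u ` N)" "u ` N \<noteq> {}"
      using Ck_embedding_openin_image[OF W(2) N(1,2)] N(3) by auto
    moreover have "continuous_map (mtop M) (mtop M) g" if "g \<in> A" for g
      using A(2) that DiffD(6) unfolding Aut_def by blast
    ultimately obtain g T where g: "g \<in> A" and T: "openin (mtop M) T" "T \<noteq> {}" "T \<subseteq> u ` N"
      and eq: "\<And>x. x \<in> T \<Longrightarrow> h x = g x"
      using dense_interiors_of_agreement[OF comp Hausdorff_points A(1) _ Hausdorff_points
          DiffD(6)[OF h] cover] by metis
    obtain t where t: "t \<in> N" "u t \<in> T" using T(2,3) by blast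
    have tW: "t \<in> W" using t(1) N(2) by blast
    have gA: "g \<in> Diff r M" "\<And>q. q \<in> frame_bundle k M \<Longrightarrow> \<omega> (frame_map k M g q) = \<omega> q"
      using A(2) g by (auto simp: Aut_def)
    have lt: "local_param k M (\<lambda>x. u (x + t))" using local_param_shift[OF W(2) tW] .
    have "u (0 + t) \<in> T" using t(2) by simp
    then obtain S where S: "open S" "0 \<in> S" "(\<lambda>x. u (x + t)) ` S \<subseteq> T"
      using local_param_open_nbhd[OF lt T(1)] by metis
    \<comment> \<open>\<open>h\<close> and \<open>g\<close> agree on a whole neighbourhood of
      \<open>u t\<close>, hence have the same jets along the frame there.\<close>
    have "(h \<circ> (\<lambda>x. u (x + t)), g \<circ> (\<lambda>x. u (x + t))) \<in> jet_rel k M"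
      using local_param_compose[OF h kr lt] local_param_compose[OF gA(1) kr lt] S(1,2)
      by (rule jet_rel_cong_open) (use S(3) eq in auto)
    then have "?Q t = jet_rel k M `` {g \<circ> (\<lambda>x. u (x + t))}"
      using equiv_class_eq[OF equiv_jet_rel] by (simp add: comp_def)
    also have "\<dots> = frame_map k M g (?P t)" using frame_map_class[OF gA(1) kr lt] by simp
    finally have "\<omega> (?Q t) = \<omega> (?P t)" using gA(2) frame_in_bundle[OF lt] by simp
    then show False using t(1) by (simp add: N_def)
  qed
  then show "\<omega> (frame_map k M h p) = \<omega> p"
    using frame_map_class[OF h kr lp] by (simp add: p comp_def)
qed

text \<open>Every r-frame based in \<open>T\<close> is fixed, as \<open>h\<close> is the identity
  near its base point. This supplies the fixed frame that freeness asks for.\<close>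

lemma frame_map_fixed:
  assumes h: "h \<in> Diff r M" and T: "openin (mtop M) T" "T \<noteq> {}" "\<And>x. x \<in> T \<Longrightarrow> h x = x"
  obtains p where "p \<in> frame_bundle r M" "frame_map r M h p = p"
proof -
  obtain x where x: "x \<in> T" "x \<in> points M" using T(1,2) openin_subset by blast
  obtain u where u: "local_param r M u" "u 0 = x" using local_param_at[OF x(2)] .
  obtain S where S: "open S" "0 \<in> S" "u ` S \<subseteq> T"
    using local_param_open_nbhd[OF u(1) T(1)] u(2) x(1) by metis
  have "(h \<circ> u, u) \<in> jet_rel r M"
    using local_param_compose[OF h order_refl u(1)] u(1) S(1,2)
    by (rule jet_rel_cong_open) (use S(3) T(3) in auto)
  then have "jet_rel r M `` {h \<circ> u} = jet_rel r M `` {u}"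
    by (rule equiv_class_eq[OF equiv_jet_rel])
  then show ?thesis
    using that[OF frame_in_bundle[OF u(1)]] frame_map_class[OF h order_refl u(1)] by simp
qed

end

section \<open>Baire category combined with freeness on frames\<close>

theorem theorem2p5:
  fixes M :: "('p, 'e::real_normed_vector) charted_space"
    and V :: "('v, 'f::real_normed_vector) charted_space"
    and \<Gamma> :: "('g, 'x) monoid_scheme"
    and \<phi> :: "'g \<Rightarrow> 'p \<Rightarrow> 'p"
    and \<alpha> :: "('e list \<Rightarrow> 'e) \<Rightarrow> 'v \<Rightarrow> 'v"
    and \<omega> :: "('e \<Rightarrow> 'p) set \<Rightarrow> 'v"
    and r k :: nat
  assumes "smooth_manifold M" and "compact_space (mtop M)"
    and "group_action \<Gamma> (points M) \<phi>" and "countable (carrier \<Gamma>)"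
    and "\<forall>\<gamma> \<in> carrier \<Gamma>. \<phi> \<gamma> \<in> Diff r M"
    and "geometric_structure k M V \<alpha> \<omega>"
    and "rigid r k M \<omega>"
    and "\<forall>\<gamma> \<in> carrier \<Gamma>. \<phi> \<gamma> \<in> Aut r k M \<omega>"
  shows "\<phi> ` carrier \<Gamma> = Inn r M \<Gamma> \<phi>"
proof -
  interpret group_action \<Gamma> "points M" \<phi> by fact
  have \<Gamma>: "group \<Gamma>" using group_hom group_hom.axioms(1) by blast
  let ?P = "points M"
  note M = assms(1)
  have Diff: "\<phi> \<gamma> \<in> Diff r M" if "\<gamma> \<in> carrier \<Gamma>" for \<gamma> using assms(5) that by blast
  have kr: "k \<le> r"
    and free: "\<And>g p. g \<in> Aut r k M \<omega> \<Longrightarrow> p \<in> frame_bundle r M \<Longrightarrow>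
      frame_map r M g p = p \<Longrightarrow> g = (\<lambda>x \<in> ?P. x)"
    using assms(7) unfolding rigid_def by blast+
  have V: "Hausdorff_space (mtop V)" and \<omega>: "continuous_map (frame_topology k M) (mtop V) \<omega>"
    using assms(6) unfolding geometric_structure_def smooth_manifold_def by blast+
  \<comment> \<open>Stated for every element of \<open>Inn\<close>, because it will be applied to a
    translate of f by the group.\<close>
  have Inn_Aut: "h \<in> Aut r k M \<omega>" if "h \<in> Inn r M \<Gamma> \<phi>" for h
  proof (rule piecewise_Aut[OF M assms(2) V \<omega>])
    show "countable (\<phi> ` carrier \<Gamma>)" using assms(4) by simp
    show "\<phi> ` carrier \<Gamma> \<subseteq> Aut r k M \<omega>" using assms(8) by blast
    show "\<exists>g \<in> \<phi> ` carrier \<Gamma>. h x = g x" if "x \<in> ?P" for x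
      using \<open>h \<in> Inn r M \<Gamma> \<phi>\<close> that by (auto simp: Inn_def orbit_def)
    show "h \<in> Diff r M" using that by (simp add: Inn_def)
  qed (rule kr)
  have "f \<in> \<phi> ` carrier \<Gamma>" if f: "f \<in> Inn r M \<Gamma> \<phi>" for f
  proof (cases "?P = {}")
    case True
    \<comment> \<open>With no points there is no nonempty open set for Baire, but all extensional
      functions on the empty set coincide.\<close>
    have "f = \<phi> \<one>\<^bsub>\<Gamma>\<^esub>"
    proof (rule extensionalityI)
      show "f \<in> extensional ?P" using f DiffD(3) by (auto simp: Inn_def)
      show "\<phi> \<one>\<^bsub>\<Gamma>\<^esub> \<in> extensional ?P"
        using DiffD(3)[OF Diff] group.is_monoid[OF \<Gamma>] monoid.one_closed by blast
    qed (use True in blast)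
    then show ?thesis using group.is_monoid[OF \<Gamma>] monoid.one_closed by blast
  next
    case False
    have fD: "f \<in> Diff r M" and orb: "\<And>x. x \<in> ?P \<Longrightarrow> \<exists>g \<in> \<phi> ` carrier \<Gamma>. f x = g x"
      using f by (auto simp: Inn_def orbit_def)
    have fP: "f x \<in> ?P" if "x \<in> ?P" for x using DiffD(2)[OF fD] that bij_betwE by blast
    have cont: "continuous_map (mtop M) (mtop M) g" if "g \<in> \<phi> ` carrier \<Gamma>" for g
      using that Diff DiffD(6) by blast
    have "countable (\<phi> ` carrier \<Gamma>)" using assms(4) by simp
    from dense_interiors_of_agreement[OF assms(2) Hausdorff_points[OF M] this cont
        Hausdorff_points[OF M] DiffD(6)[OF fD] orb openin_topspace False]
    obtain g T where g: "g \<in> \<phi> ` carrier \<Gamma>"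
      and T: "openin (mtop M) T" "T \<noteq> {}" "\<And>x. x \<in> T \<Longrightarrow> f x = g x" by metis
    obtain \<gamma> where \<gamma>: "\<gamma> \<in> carrier \<Gamma>" "g = \<phi> \<gamma>" using g by blast
    have inv: "inv\<^bsub>\<Gamma>\<^esub> \<gamma> \<in> carrier \<Gamma>" using group.inv_closed[OF \<Gamma> \<gamma>(1)] .
    \<comment> \<open>\<open>h\<close> is the identity on \<open>T\<close>, and sends x to the image
      of x under the product of the inverse of \<open>\<gamma>\<close> with some
      \<open>\<delta>\<close>, so it stays in the orbit of x. It is thus an automorphism of
      \<open>\<omega>\<close> with a fixed r-frame.\<close>
    define h where "h = compose ?P (\<phi> (inv\<^bsub>\<Gamma>\<^esub> \<gamma>)) f"
    have h: "h x = \<phi> (inv\<^bsub>\<Gamma>\<^esub> \<gamma>) (f x)" if "x \<in> ?P" for x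
      using that by (simp add: h_def compose_def)
    have hD: "h \<in> Diff r M" unfolding h_def using Diff_compose[OF M Diff[OF inv] fD] .
    have "h x \<in> orbit \<Gamma> \<phi> x" if x: "x \<in> ?P" for x
    proof -
      obtain \<delta> where \<delta>: "\<delta> \<in> carrier \<Gamma>" "f x = \<phi> \<delta> x" using orb[OF x] by blast
      have "h x = \<phi> (inv\<^bsub>\<Gamma>\<^esub> \<gamma> \<otimes>\<^bsub>\<Gamma>\<^esub> \<delta>) x"
        using h[OF x] \<delta> composition_rule[OF x inv \<delta>(1)] by simp
      moreover have "inv\<^bsub>\<Gamma>\<^esub> \<gamma> \<otimes>\<^bsub>\<Gamma>\<^esub> \<delta> \<in> carrier \<Gamma>"
        using group.is_monoid[OF \<Gamma>] inv \<delta>(1) monoid.m_closed by metis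
      ultimately show ?thesis by (auto simp: orbit_def)
    qed
    then have hA: "h \<in> Aut r k M \<omega>" using hD Inn_Aut by (simp add: Inn_def)
    have "h x = x" if "x \<in> T" for x
    proof -
      have x: "x \<in> ?P" using that openin_subset[OF T(1)] by blast
      show ?thesis
        using h[OF x] T(3)[OF that] \<gamma>(2) orbit_sym_aux[OF \<gamma>(1) x refl] by simp
    qed
    then obtain p where "p \<in> frame_bundle r M" "frame_map r M h p = p"
      using frame_map_fixed[OF M hD T(1,2)] by metis
    then have hid: "h = (\<lambda>x \<in> ?P. x)" using free hA by blast
    have "f = \<phi> \<gamma>"
    proof (rule extensionalityI)
      show "f \<in> extensional ?P" using DiffD(3)[OF fD] .
      show "\<phi> \<gamma> \<in> extensional ?P" using DiffD(3)[OF Diff[OF \<gamma>(1)]] .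
      fix x assume x: "x \<in> ?P"
      have "\<phi> (inv\<^bsub>\<Gamma>\<^esub> \<gamma>) (f x) = x" using h[OF x] hid x by simp
      from orbit_sym_aux[OF inv fP[OF x] this] show "f x = \<phi> \<gamma> x"
        using group.inv_inv[OF \<Gamma> \<gamma>(1)] by simp
    qed
    then show ?thesis using \<gamma>(1) by blast
  qed
  moreover have "\<phi> \<gamma> \<in> Inn r M \<Gamma> \<phi>" if "\<gamma> \<in> carrier \<Gamma>" for \<gamma>
    using Diff[OF that] that by (auto simp: Inn_def orbit_def)
  ultimately show ?thesis by blast
qed

end
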